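(* For every fixed $\alpha > 0$, if the arc probability of the random digraph $\mathcal{D}(n,p)$ satisfies $\log n/\sqrt{n} \ll p = p(n) \leq 1$, then asymptotically almost surely $$(1/2 - \alpha)\, n p \;\leq\; r_{\ell}(\mathcal{D}(n,p), \mathcal{H}) \;\leq\; (1/2 + \alpha)\, n p .$$
   Context: $\mathcal{D}(n,p)$ is the random digraph on vertex set $[n]$ in which each ordered pair $(u,v)$, $u \neq v$, is an arc independently with probability $p$. $\mathcal{H}$ is the digraph property of containing a directed Hamilton cycle. For a digraph $D$ and a monotone increasing property $\mathcal{P}$, the local resilience $r_\ell(D,\mathcal{P})$ is the smallest non-negative integer $r$ such that there is a subdigraph $H \subseteq D$ with maximum out-degree $\Delta^+(H)\le r$ and maximum in-degree $\Delta^-(H) \le r$ such that $D \setminus H$ (delete the arcs of $H$) does not satisfy $\mathcal{P}$. "Asymptotically almost surely" (a.a.s.) means with probability tending to $1$ as $n \to \infty$; $f \ll g$ means $f/g \to 0$. Logarithms are natural. *)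

theory Defs
  imports Complex_Main "HOL-Library.Landau_Symbols"
begin

text \<open>Digraphs on the vertex set [n], represented as {0..<n}; a digraph is its arc set.\<close>

definition all_arcs :: "nat \<Rightarrow> (nat \<times> nat) set" where
  "all_arcs n = {(u, v). u < n \<and> v < n \<and> u \<noteq> v}"

text \<open>Probability that the random digraph D(n,p) has property P: each of the
  n(n-1) possible arcs is present independently with probability p.\<close>
definition Dnp_prob :: "nat \<Rightarrow> real \<Rightarrow> ((nat \<times> nat) set \<Rightarrow> bool) \<Rightarrow> real" where
  "Dnp_prob n p P =
     (\<Sum>D\<in>Pow (all_arcs n).
        (if P D then p ^ card D * (1 - p) ^ (card (all_arcs n) - card D) else 0))"

definition hamiltonian :: "nat \<Rightarrow> (nat \<times> nat) set \<Rightarrow> bool" where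
  "hamiltonian n D \<longleftrightarrow>
     (\<exists>vs. length vs = n \<and> distinct vs \<and> set vs = {0..<n} \<and>
           (\<forall>i<n. (vs ! i, vs ! ((i + 1) mod n)) \<in> D))"

definition out_deg :: "(nat \<times> nat) set \<Rightarrow> nat \<Rightarrow> nat" where
  "out_deg H u = card {v. (u, v) \<in> H}"

definition in_deg :: "(nat \<times> nat) set \<Rightarrow> nat \<Rightarrow> nat" where
  "in_deg H v = card {u. (u, v) \<in> H}"

definition local_resilience_ham :: "nat \<Rightarrow> (nat \<times> nat) set \<Rightarrow> nat" where
  "local_resilience_ham n D =
     (LEAST r. \<exists>H. H \<subseteq> D \<and> (\<forall>u. out_deg H u \<le> r) \<and> (\<forall>v. in_deg H v \<le> r)
                   \<and> \<not> hamiltonian n (D - H))"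

end

theory Submission
  imports Defs "HOL-Library.FuncSet" "HOL-Real_Asymp.Real_Asymp"
begin

text \<open>Upper bound: deleting all arcs from one half of the vertices to the other destroys all Hamilton
  cycles and, by Chernoff's inequality, costs at most (1/2 + \<alpha>)np arcs at each vertex.

  Lower bound: let G be what remains of D(n,p) after deleting fewer than (1/2 - \<alpha>)np arcs in each
  direction at each vertex, and let m be a large multiple of log n / p; then m is much smaller than
  np. Since D(n,p) has no unusually dense pairs of vertex sets, in G every set of m vertices has more
  than n/2 out-neighbours and more than n/2 in-neighbours, so that any two vertices are joined by a
  path of length 4, and also by an antidirected one, avoiding any prescribed set of O(m) vertices.
  A random balanced partition of all but O(m) vertices into parts of size m, together with Hall's
  theorem between consecutive parts, covers these vertices by m paths from a fixed m-set Y to a fixed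
  m-set X, but which end is joined to which start is not under control. This is repaired by the
  remaining O(m) vertices, which are fixed before the partition. They form m paths from X to Y with
  m - 1 switches: eight vertices u1, w1, ..., u4, w4 with arcs from uj to wj and to w(j+1), where
  u1 w1 and u3 w3 lie on wire 0 and u2 w2 and u4 w4 on wire i. If wires 0 and i lie on different
  cycles of the current 1-factor, exchanging the arcs of the i-th switch merges these two cycles.
  Processing the switches one by one yields a Hamilton cycle.\<close>

section \<open>1-factors as one-to-one relations\<close>

text \<open>The form of the switch is dictated by what survives the deletion. Two cycles could be
  merged by exchanging two arcs, but this requires two vertices with two common out-neighbours, and
  expansion of m-sets does not supply these: it yields connections of length 4 between single
  vertices. The eight vertices of a switch therefore form an antidirected 8-cycle, glued from two
  antidirected paths of length 4 with common ends u1 and u3. The exchange composes the 1-factor with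
  a 4-cycle on u1, ..., u4, an odd permutation, so the parity of the number of cycles changes, as a
  merge of two cycles demands.

  The lower bound is a budget for the slack, with b = min \<alpha> 1 / 8. The deletion leaves an
  excess of at least 8b over one half, in units of np. Degree fluctuations reduce it to 7b and the
  loss of the fixed vertices to 6b. Concentration inside a part of size m leaves (1/2 + 4b)pm, and
  Hall's condition needs more than about (1 + b)pm/2. Every union bound requires pm to be a large
  multiple of log n, while the fixed O(m) vertices may cost only b np; together this is the demand
  that n p^2 be a large multiple of log n.\<close>

definition one_one :: "('a \<times> 'b) set \<Rightarrow> bool" where
  "one_one M \<longleftrightarrow> single_valued M \<and> single_valued (M\<inverse>)"

text \<open>A permutation of \<open>V\<close> written as a relation, that is, a cover of
  \<open>V\<close> by disjoint directed cycles. It is assembled from partial pieces (wires and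
  matchings) by unions, which relations support directly; domain and range record which vertices
  already have their outgoing or incoming arc.\<close>

definition one_factor :: "'a set \<Rightarrow> ('a \<times> 'a) set \<Rightarrow> bool" where
  "one_factor V S \<longleftrightarrow> one_one S \<and> Domain S = V \<and> Range S = V"

definition edges :: "'a list \<Rightarrow> ('a \<times> 'a) set" where
  "edges q = set (zip q (tl q))"

lemma one_oneD:
  assumes "one_one M"
  shows "(x, y) \<in> M \<Longrightarrow> (x, z) \<in> M \<Longrightarrow> y = z" and "(x, z) \<in> M \<Longrightarrow> (y, z) \<in> M \<Longrightarrow> x = y"
  using assms unfolding one_one_def single_valued_def by blast+

lemma one_one_Un:
  assumes "one_one M" "one_one N" "Domain M \<inter> Domain N = {}" "Range M \<inter> Range N = {}"
  shows "one_one (M \<union> N)"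
proof -
  have "single_valued (P \<union> Q)"
    if "single_valued P" "single_valued Q" "Domain P \<inter> Domain Q = {}" for P Q :: "('c \<times> 'd) set"
    using that by (auto simp: single_valued_def)
  from this[of M N] this[of "M\<inverse>" "N\<inverse>"] show ?thesis
    using assms by (simp add: one_one_def converse_Un)
qed

lemma one_one_insert:
  assumes "one_one M" "x \<notin> Domain M" "y \<notin> Range M"
  shows "one_one (insert (x, y) M)"
  using assms unfolding one_one_def single_valued_def by auto

lemma one_one_empty [simp]: "one_one {}"
  by (simp add: one_one_def)

section \<open>Directed paths as arc sets\<close>

lemma edges_simps [simp]:
  "edges [] = {}" "edges [x] = {}" "edges (x # y # q) = insert (x, y) (edges (y # q))"
  by (auto simp: edges_def)

lemma edges_append: "edges (xs @ y # ys) = edges (xs @ [y]) \<union> edges (y # ys)"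
proof (induction xs)
  case (Cons x xs)
  then show ?case by (cases xs) auto
qed simp

lemma edges_append_split:
  "edges (xs @ y # z # ys) = edges (xs @ [y]) \<union> edges (y # z # ys)"
  "edges (x # xs @ y # z # ys) = edges (x # xs @ [y]) \<union> edges (y # z # ys)"
  using edges_append[of xs y "z # ys"] edges_append[of "x # xs" y "z # ys"] by simp_all

lemma Domain_edges: "Domain (edges q) = set (butlast q)"
proof (induction q)
  case (Cons x q)
  then show ?case by (cases q) auto
qed simp

lemma Range_edges: "Range (edges q) = set (tl q)"
proof (induction q)
  case (Cons x q)
  then show ?case by (cases q) auto
qed simp

lemma one_one_edges:
  assumes "distinct q"
  shows "one_one (edges q)"
  using assms
proof (induction q)
  case (Cons x q)
  show ?case
  proof (cases q)
    case (Cons y r)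
    have "x \<notin> Domain (edges q)"
      using Cons.prems by (auto simp: Domain_edges dest: in_set_butlastD)
    moreover have "y \<notin> Range (edges q)"
      using Cons.prems Cons by (auto simp: Range_edges)
    moreover have "one_one (edges q)" using Cons.IH Cons.prems by simp
    ultimately show ?thesis
      using one_one_insert Cons by fastforce
  qed simp
qed simp

lemma edges_reach:
  assumes "y \<in> set (x # q)"
  shows "(x, y) \<in> (edges (x # q))\<^sup>*"
  using assms
proof (induction q arbitrary: x)
  case (Cons z q)
  show ?case
  proof (cases "y = x")
    case False
    then have "(z, y) \<in> (edges (z # q))\<^sup>*" using Cons by auto
    then have "(z, y) \<in> (edges (x # z # q))\<^sup>*"
      by (rule rtrancl_mono[THEN subsetD, rotated]) auto
    then show ?thesis by (auto intro: converse_rtrancl_into_rtrancl)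
  qed simp
qed simp

text \<open>This turns \<open>S\<^sup>*\<close> into the relation of lying on a common cycle; all
  later statements about cycles are phrased through it.\<close>

lemma one_factor_rtrancl_sym:
  assumes "one_factor V S" "finite V" "(a, b) \<in> S\<^sup>*"
  shows "(b, a) \<in> S\<^sup>*"
  using assms(3)
proof (induction rule: rtrancl_induct)
  case (step y z)
  have oo: "one_one S" and dom: "Domain S = V" and ran: "Range S = V"
    using assms(1) by (auto simp: one_factor_def)
  \<comment> \<open>S maps the finite set of points reachable from z injectively into itself, hence onto itself.\<close>
  define R where "R = S\<^sup>* `` {z}"
  define f where "f v = (THE w. (v, w) \<in> S)" for v
  have f: "(v, f v) \<in> S" if "v \<in> V" for v
  proof -
    have "v \<in> Domain S" using that dom by simp
    then obtain w where w: "(v, w) \<in> S" by blast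
    then have "f v = w" unfolding f_def using one_oneD(1)[OF oo] by blast
    then show ?thesis using w by simp
  qed
  have zV: "z \<in> V" using step ran by blast
  have RV: "R \<subseteq> V"
  proof
    fix v assume "v \<in> R"
    then have "(z, v) \<in> S\<^sup>*" by (simp add: R_def)
    then show "v \<in> V" using zV ran by (cases rule: rtranclE) auto
  qed
  have "f ` R \<subseteq> R"
    using f RV by (auto simp: R_def dest: subsetD intro: rtrancl_into_rtrancl)
  moreover have "inj_on f R"
    using f RV one_oneD(2)[OF oo] unfolding inj_on_def by (metis subsetD)
  ultimately have "f ` R = R"
    using finite_subset[OF RV assms(2)] endo_inj_surj by blast
  moreover have "z \<in> R" by (simp add: R_def)
  ultimately obtain v where v: "v \<in> R" "f v = z" by (metis imageE)
  then have "(v, z) \<in> S" using f RV by blast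
  then have "v = y" using step one_oneD(2)[OF oo] by blast
  then have "(z, y) \<in> S\<^sup>*" using v by (simp add: R_def)
  then show ?case using step by simp
qed simp

text \<open>Iterating the successor function from 0 traverses the cycle of 0. By \<open>conn\<close>
  this cycle contains every vertex, so its least period is \<open>n\<close> and the iterates up to
  it form the required list.\<close>

lemma one_factor_hamiltonian:
  assumes S: "one_factor {0..<n} S" and "S \<subseteq> D" and n: "0 < n"
    and conn: "\<And>v. v < n \<Longrightarrow> (0, v) \<in> S\<^sup>*"
  shows "hamiltonian n D"
proof -
  have oo: "one_one S" and dom: "Domain S = {0..<n}" and ran: "Range S = {0..<n}"
    using S by (auto simp: one_factor_def)
  define f where "f v = (THE w. (v, w) \<in> S)" for v
  have f: "(v, f v) \<in> S" if "v < n" for v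
  proof -
    have "v \<in> Domain S" using that dom by simp
    then obtain w where w: "(v, w) \<in> S" by blast
    then have "f v = w" unfolding f_def using one_oneD(1)[OF oo] by blast
    then show ?thesis using w by simp
  qed
  have fn: "f v < n" if "v < n" for v
    using f[OF that] ran by (metis RangeI atLeastLessThan_iff)
  have itn: "(f ^^ i) 0 < n" for i
    by (induction i) (use n fn in auto)
  have inj: "v = w" if "v < n" "w < n" "f v = f w" for v w
    using f[OF that(1)] f[OF that(2)] that(3) one_oneD(2)[OF oo] by metis
  \<comment> \<open>Injectivity of \<open>f\<close> pulls a coincidence of two iterates back to 0.
    Hence the iterates below the least period are distinct.\<close>
  have cancel: "(f ^^ j) 0 = 0" if "(f ^^ (i + j)) 0 = (f ^^ i) 0" for i j
    using that
  proof (induction i)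
    case (Suc i)
    then show ?case using inj[OF itn itn, of "i + j" i] by simp
  qed simp
  have reach: "\<exists>k. v = (f ^^ k) 0" if "(0, v) \<in> S\<^sup>*" for v
    using that
  proof (induction rule: rtrancl_induct)
    case base
    then show ?case by (intro exI[of _ 0]) simp
  next
    case (step y z)
    then obtain k where k: "y = (f ^^ k) 0" by blast
    then have "(y, f y) \<in> S" using f itn by blast
    then have "z = f y" using step one_oneD(1)[OF oo] by blast
    then show ?case using k by (intro exI[of _ "Suc k"]) simp
  qed
  have "\<exists>k>0. (f ^^ k) 0 = 0"
  proof -
    have "0 \<in> Range S" using ran n by simp
    then obtain v where v: "(v, 0) \<in> S" by blast
    then have vn: "v < n" using dom by (metis Domain.DomainI atLeastLessThan_iff)
    then obtain k where "v = (f ^^ k) 0" using conn reach by blast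
    moreover have "f v = 0" using f[OF vn] v one_oneD(1)[OF oo] by blast
    ultimately show ?thesis by (intro exI[of _ "Suc k"]) simp
  qed
  then have ex: "\<exists>k. k > 0 \<and> (f ^^ k) 0 = 0" by simp
  define k where "k = (LEAST k. k > 0 \<and> (f ^^ k) 0 = 0)"
  have k: "k > 0" "(f ^^ k) 0 = 0"
    using LeastI_ex[OF ex] by (auto simp: k_def)
  have least: "(f ^^ j) 0 \<noteq> 0" if "0 < j" "j < k" for j
    using not_less_Least[of j "\<lambda>k. k > 0 \<and> (f ^^ k) 0 = 0"] that by (auto simp: k_def)
  have mod: "(f ^^ i) 0 = (f ^^ (i mod k)) 0" for i
    by (metis k(2) funpow_mod_eq)
  define vs where "vs = map (\<lambda>i. (f ^^ i) 0) [0..<k]"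
  have "inj_on (\<lambda>i. (f ^^ i) 0) {0..<k}"
  proof (rule linorder_inj_onI)
    fix i j assume "i < j" "i \<in> {0..<k}" "j \<in> {0..<k}"
    then show "(f ^^ i) 0 \<noteq> (f ^^ j) 0"
      using cancel[of i "j - i"] least[of "j - i"] by auto
  qed auto
  then have dist: "distinct vs" by (simp add: vs_def distinct_map)
  have set: "set vs = {0..<n}"
  proof
    show "set vs \<subseteq> {0..<n}" using itn by (auto simp: vs_def)
    show "{0..<n} \<subseteq> set vs"
    proof
      fix v assume "v \<in> {0..<n}"
      then obtain i where "v = (f ^^ i) 0" using conn reach by fastforce
      then have "v = (f ^^ (i mod k)) 0" using mod by simp
      then show "v \<in> set vs" using k(1) by (auto simp: vs_def)
    qed
  qed
  have kn: "k = n" using distinct_card[OF dist] set by (simp add: vs_def)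
  have "(vs ! i, vs ! ((i + 1) mod n)) \<in> D" if "i < n" for i
  proof -
    have "vs ! ((i + 1) mod n) = (f ^^ ((i + 1) mod k)) 0"
      using kn that by (simp add: vs_def)
    also have "\<dots> = f ((f ^^ i) 0)" using mod[of "i + 1"] by simp
    finally show ?thesis using f[OF itn[of i]] that kn assms(2) by (auto simp: vs_def)
  qed
  then show ?thesis
    unfolding hamiltonian_def using dist set kn by (intro exI[of _ vs]) (auto simp: vs_def)
qed

text \<open>Exchanging the arcs of a switch whose two wires lie on different cycles merges these cycles.\<close>

lemma toggle:
  fixes S :: "('a \<times> 'a) set"
  assumes S: "one_factor V S" and fin: "finite V"
    and u: "distinct [u1, u2, u3, u4]"
    and uw: "(u1, w1) \<in> S" "(u2, w2) \<in> S" "(u3, w3) \<in> S" "(u4, w4) \<in> S"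
    and r1: "edges (w1 # r1 @ [u3]) \<subseteq> S" "set (w1 # r1) \<inter> {u1, u2, u3, u4} = {}"
    and r2: "edges (w2 # r2 @ [u4]) \<subseteq> S" "set (w2 # r2) \<inter> {u1, u2, u3, u4} = {}"
    and diff: "(u1, u2) \<notin> S\<^sup>*"
  defines "S' \<equiv> {(a, b) \<in> S. a \<notin> {u1, u2, u3, u4}} \<union> {(u1, w2), (u2, w3), (u3, w4), (u4, w1)}"
  shows "one_factor V S'" and "S\<^sup>* \<subseteq> S'\<^sup>*" and "(u1, u2) \<in> S'\<^sup>*"
proof -
  let ?T = "{u1, u2, u3, u4}"
  have oo: "one_one S" and dom: "Domain S = V" and ran: "Range S = V"
    using S by (auto simp: one_factor_def)
  note sv = one_oneD(1)[OF oo] and iv = one_oneD(2)[OF oo]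
  have w: "distinct [w1, w2, w3, w4]" using u uw iv by (metis distinct_length_2_or_more distinct_singleton)
  have "Domain S' = V"
    using dom uw by (auto simp: S'_def)
  moreover have "Range S' = V"
  proof
    show "Range S' \<subseteq> V" using ran uw by (auto simp: S'_def)
    show "V \<subseteq> Range S'"
    proof
      fix b assume "b \<in> V"
      then obtain a where a: "(a, b) \<in> S" using ran by blast
      then have "a \<in> ?T \<Longrightarrow> b \<in> {w1, w2, w3, w4}" using uw sv by auto
      then show "b \<in> Range S'" using a by (cases "a \<in> ?T") (auto simp: S'_def)
    qed
  qed
  moreover have "one_one S'"
  proof -
    have ow: "b \<notin> {w1, w2, w3, w4}" if "(a, b) \<in> S" "a \<notin> ?T" for a b
      using that uw iv by auto
    have "one_one {(a, b) \<in> S. a \<notin> ?T}"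
      using sv iv unfolding one_one_def single_valued_def by blast
    moreover have "one_one {(u1, w2), (u2, w3), (u3, w4), (u4, w1)}"
      using u w by (auto intro!: one_one_insert)
    ultimately show ?thesis
      unfolding S'_def by (rule one_one_Un) (use ow in blast)+
  qed
  ultimately show of': "one_factor V S'" by (simp add: one_factor_def)
  note sym' = one_factor_rtrancl_sym[OF of' fin]
  have new: "(u1, w2) \<in> S'" "(u2, w3) \<in> S'" "(u3, w4) \<in> S'" "(u4, w1) \<in> S'"
    by (auto simp: S'_def)
  have seg: "(x, y) \<in> S'\<^sup>*" if "edges (x # r @ [y]) \<subseteq> S" "set (x # r) \<inter> ?T = {}" for x y r
  proof -
    have "edges (x # r @ [y]) \<subseteq> S'"
    proof
      fix e assume e: "e \<in> edges (x # r @ [y])"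
      obtain a b where ab: "e = (a, b)" by (cases e)
      then have "a \<in> Domain (edges (x # r @ [y]))" using e by blast
      then have "a \<in> set (x # r)" by (simp add: Domain_edges butlast_append split: if_splits)
      then show "e \<in> S'" using e ab that by (auto simp: S'_def)
    qed
    then show ?thesis using edges_reach[of y x "r @ [y]"] rtrancl_mono by auto
  qed
  have s1: "(w1, u3) \<in> S'\<^sup>*" and s2: "(w2, u4) \<in> S'\<^sup>*" using seg r1 r2 by blast+
  \<comment> \<open>\<open>K\<close> is the new cycle of \<open>u1\<close>. Alternating new arcs
    with the two preserved segments, it passes through w2, u4, w1, u3 and w4; only \<open>u2\<close>
    and \<open>w3\<close> then remain to be placed.\<close>
  define K where "K = S'\<^sup>* `` {u1}"
  have closed: "y \<in> K" if "x \<in> K" "(x, y) \<in> S'\<^sup>*" for x y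
    using that unfolding K_def by (auto intro: rtrancl_trans)
  have "u1 \<in> K" by (simp add: K_def)
  then have "w2 \<in> K" using new closed by blast
  then have "u4 \<in> K" using s2 closed by blast
  then have "w1 \<in> K" using new closed by blast
  then have "u3 \<in> K" using s1 closed by blast
  then have "w4 \<in> K" using new closed by blast
  note K = \<open>u1 \<in> K\<close> \<open>w2 \<in> K\<close> \<open>u4 \<in> K\<close> \<open>w1 \<in> K\<close> \<open>u3 \<in> K\<close> \<open>w4 \<in> K\<close>
  have reachS: "(x, y) \<in> S\<^sup>*" if "edges (x # r @ [y]) \<subseteq> S" for x y r
    using that edges_reach[of y x "r @ [y]"] rtrancl_mono by auto
  note sym = one_factor_rtrancl_sym[OF S fin]
  have u24: "(u4, u2) \<in> S\<^sup>*" and u13: "(u1, u3) \<in> S\<^sup>*"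
    using reachS[OF r2(1)] reachS[OF r1(1)] uw sym by (meson converse_rtrancl_into_rtrancl)+
  have w42: "(w4, u2) \<in> S\<^sup>*" using uw u24 sym by (meson rtrancl_trans r_into_rtrancl)
  have no: "(w4, u1) \<notin> S\<^sup>*" "(w4, u3) \<notin> S\<^sup>*"
    using w42 u13 sym diff by (meson rtrancl_trans)+
  \<comment> \<open>Following S from w4 one can leave K only through u2.\<close>
  have "u2 \<in> K"
  proof (rule ccontr)
    assume n2: "u2 \<notin> K"
    have "x \<in> K" if "(w4, x) \<in> S\<^sup>*" for x
      using that
    proof (induction rule: rtrancl_induct)
      case (step y z)
      show ?case
      proof (cases "y \<in> ?T")
        case True
        then have "y = u4" using step no n2 by auto
        then have "z = w4" using step uw sv by blast
        then show ?thesis using K by simp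
      next
        case False
        then have "(y, z) \<in> S'" using step by (auto simp: S'_def)
        then show ?thesis using closed step by blast
      qed
    qed (use K in simp)
    then show False using w42 n2 by blast
  qed
  then have "w3 \<in> K" using new closed by blast
  show "(u1, u2) \<in> S'\<^sup>*" using \<open>u2 \<in> K\<close> by (simp add: K_def)
  have KK: "(x, y) \<in> S'\<^sup>*" if "x \<in> K" "y \<in> K" for x y
    using that sym' unfolding K_def by (meson Image_singleton_iff rtrancl_trans)
  \<comment> \<open>The four deleted arcs have both ends in \<open>K\<close>, so no old connection
    is lost.\<close>
  have "S \<subseteq> S'\<^sup>*"
  proof
    fix e assume e: "e \<in> S"
    obtain a b where ab: "e = (a, b)" by (cases e)
    show "e \<in> S'\<^sup>*"
    proof (cases "a \<in> ?T")
      case True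
      then have "b \<in> {w1, w2, w3, w4}" using e ab uw sv by auto
      then show ?thesis using True KK K \<open>u2 \<in> K\<close> \<open>w3 \<in> K\<close> ab by auto
    next
      case False
      then show ?thesis using e ab by (auto simp: S'_def)
    qed
  qed
  then show "S\<^sup>* \<subseteq> S'\<^sup>*" by (metis rtrancl_mono rtrancl_idemp)
qed

section \<open>The switching structure in an expanding digraph\<close>

text \<open>The bound 28 m leaves room for the complete switching structure, which has fewer than 28 m
  vertices.\<close>

locale expanding_digraph =
  fixes n m :: nat and G :: "(nat \<times> nat) set"
  assumes arcs: "G \<subseteq> all_arcs n"
    and m_pos: "0 < m"
    and out_large: "v < n \<Longrightarrow> 30 * m \<le> card (G `` {v})"
    and in_large: "v < n \<Longrightarrow> 30 * m \<le> card (G\<inverse> `` {v})"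
    and out_expand: "A \<subseteq> {0..<n} \<Longrightarrow> card A = m \<Longrightarrow> n + 28 * m < 2 * card (G `` A)"
    and in_expand: "A \<subseteq> {0..<n} \<Longrightarrow> card A = m \<Longrightarrow> n + 28 * m < 2 * card (G\<inverse> `` A)"
begin

section \<open>Short connections that avoid a prescribed set\<close>

lemma arc_lt: "(a, b) \<in> G \<Longrightarrow> a < n" "(a, b) \<in> G \<Longrightarrow> b < n" "(a, b) \<in> G \<Longrightarrow> a \<noteq> b"
  using arcs by (auto simp: all_arcs_def)

text \<open>After removal of \<open>F\<close> one finds disjoint m-sets in \<open>A\<close> and
  \<open>C\<close>; 30 = 28 + 1 + 1 pays for \<open>F\<close> and for these two sets. Their images
  each have more than n/2 + 14 m elements, so they share more than 28 m vertices, one of which lies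
  outside \<open>F\<close>. Two relations are allowed so that one argument serves directed and
  antidirected connections.\<close>

lemma common_neighbour:
  assumes A: "A \<subseteq> {0..<n}" "30 * m \<le> card A" and C: "C \<subseteq> {0..<n}" "30 * m \<le> card C"
    and F: "finite F" "card F \<le> 28 * m"
    and R1: "R1 \<subseteq> UNIV \<times> {0..<n}" "\<And>A. A \<subseteq> {0..<n} \<Longrightarrow> card A = m \<Longrightarrow> n + 28 * m < 2 * card (R1 `` A)"
    and R2: "R2 \<subseteq> UNIV \<times> {0..<n}" "\<And>A. A \<subseteq> {0..<n} \<Longrightarrow> card A = m \<Longrightarrow> n + 28 * m < 2 * card (R2 `` A)"
  obtains a b c where "a \<in> A - F" "c \<in> C - F" "b \<notin> F" "a \<noteq> c" "(a, b) \<in> R1" "(c, b) \<in> R2"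
proof -
  have "m \<le> card (A - F)"
    using A F diff_card_le_card_Diff[of F A] by linarith
  then obtain A' where A': "A' \<subseteq> A - F" "card A' = m" "finite A'" by (rule obtain_subset_with_card_n)
  have "card (F \<union> A') \<le> 29 * m"
    using card_Un_le[of F A'] F A' by linarith
  then have "m \<le> card (C - (F \<union> A'))"
    using C diff_card_le_card_Diff[of "F \<union> A'" C] F A' by (simp add: finite_subset)
  then obtain C' where C': "C' \<subseteq> C - (F \<union> A')" "card C' = m" by (rule obtain_subset_with_card_n)
  have big: "n + 28 * m < 2 * card (R1 `` A')" "n + 28 * m < 2 * card (R2 `` C')"
    using R1(2)[of A'] R2(2)[of C'] A A' C C' by auto
  have sub: "R1 `` A' \<subseteq> {0..<n}" "R2 `` C' \<subseteq> {0..<n}" using R1 R2 by auto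
  then have fin: "finite (R1 `` A')" "finite (R2 `` C')" by (meson finite_subset finite_atLeastLessThan)+
  have "card (R1 `` A' \<union> R2 `` C') \<le> n"
    using card_mono[of "{0..<n}" "R1 `` A' \<union> R2 `` C'"] sub by simp
  then have "card F < card (R1 `` A' \<inter> R2 `` C')"
    using card_Un_Int[OF fin] big F by linarith
  then have "\<not> R1 `` A' \<inter> R2 `` C' \<subseteq> F"
    using card_mono[OF F(1)] by (meson not_less)
  then obtain b where "b \<in> R1 `` A'" "b \<in> R2 `` C'" "b \<notin> F" by blast
  then obtain a c where "a \<in> A'" "(a, b) \<in> R1" "c \<in> C'" "(c, b) \<in> R2" by blast
  then show thesis using that[of a c b] A' C' \<open>b \<notin> F\<close> by blast
qed

lemma Image_in_vertices: "G \<subseteq> UNIV \<times> {0..<n}" "G\<inverse> \<subseteq> UNIV \<times> {0..<n}"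
  "G `` B \<subseteq> {0..<n}" "G\<inverse> `` B \<subseteq> {0..<n}"
  using arc_lt by (auto simp: Image_def)

text \<open>Only the inner vertices avoid \<open>F\<close>; \<open>x\<close> and \<open>y\<close>
  may belong to it. Thus \<open>F\<close> can be the set of all vertices used so far, which contains
  the ends to be joined.\<close>

lemma connect:
  assumes "x < n" "y < n" "finite F" "card F \<le> 28 * m"
  obtains r where "length r = 3" "distinct r" "set r \<subseteq> {0..<n}" "set r \<inter> F = {}"
    "edges (x # r @ [y]) \<subseteq> G"
proof -
  obtain a b c where abc: "a \<in> G `` {x} - F" "c \<in> G\<inverse> `` {y} - F" "b \<notin> F" "a \<noteq> c" "(a, b) \<in> G" "(c, b) \<in> G\<inverse>"
    by (rule common_neighbour[OF Image_in_vertices(3) out_large[OF assms(1)] Image_in_vertices(4) in_large[OF assms(2)] assms(3,4)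
          Image_in_vertices(1) out_expand Image_in_vertices(2) in_expand])
  then show thesis using that[of "[a, b, c]"] arc_lt by auto
qed

text \<open>The middle vertex \<open>b\<close> is an in-neighbour both of an out-neighbour of
  \<open>x\<close> and of an out-neighbour of \<open>y\<close>, so in-expansion is applied on both
  sides.\<close>

lemma antidirected_connect:
  assumes "x < n" "y < n" "finite F" "card F \<le> 28 * m"
  obtains a b c where "distinct [a, b, c]" "{a, b, c} \<subseteq> {0..<n}" "{a, b, c} \<inter> F = {}"
    "(x, a) \<in> G" "(b, a) \<in> G" "(b, c) \<in> G" "(y, c) \<in> G"
proof -
  obtain a b c where abc: "a \<in> G `` {x} - F" "c \<in> G `` {y} - F" "b \<notin> F" "a \<noteq> c" "(a, b) \<in> G\<inverse>" "(c, b) \<in> G\<inverse>"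
    by (rule common_neighbour[OF Image_in_vertices(3) out_large[OF assms(1)] Image_in_vertices(3) out_large[OF assms(2)] assms(3,4)
          Image_in_vertices(2) in_expand Image_in_vertices(2) in_expand])
  then show thesis
    using that[of a b c] arc_lt(1,2) arc_lt(3)[of b a] arc_lt(3)[of b c] by auto
qed

lemma extend_path:
  assumes "x < n" "finite F" "card F + z \<le> 28 * m"
  shows "\<exists>r. length r = z \<and> distinct r \<and> set r \<subseteq> {0..<n} \<and> set r \<inter> F = {} \<and> edges (x # r) \<subseteq> G"
  using assms
proof (induction z arbitrary: x F)
  case (Suc z)
  have "card F < card (G `` {x})" using out_large[OF Suc.prems(1)] Suc.prems m_pos by linarith
  then have "\<not> G `` {x} \<subseteq> F" using card_mono[OF Suc.prems(2)] by (meson not_less)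
  then obtain y where y: "(x, y) \<in> G" "y \<notin> F" by blast
  have "card (insert y F) + z \<le> 28 * m" using Suc.prems y by simp
  then obtain r where "length r = z" "distinct r" "set r \<subseteq> {0..<n}" "set r \<inter> insert y F = {}" "edges (y # r) \<subseteq> G"
    using Suc.IH[of y "insert y F"] y arc_lt Suc.prems by auto
  then show ?case using y arc_lt by (intro exI[of _ "y # r"]) auto
qed simp

text \<open>All 1-factors through \<open>M\<close> are quantified over because the structure is
  fixed before the matchings that complete it are known. The switches may only change arcs that
  leave \<open>Domain M\<close>, they never separate vertices of a common cycle, and they bring each
  pair of \<open>Q\<close> onto a common cycle. The locality clause is what allows switches to be
  processed one after another.\<close>

definition switchable :: "(nat \<times> nat) set \<Rightarrow> (nat \<times> nat) set \<Rightarrow> bool" where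
  "switchable M Q \<longleftrightarrow> (\<forall>S. one_factor {0..<n} S \<longrightarrow> S \<subseteq> G \<longrightarrow> M \<subseteq> S \<longrightarrow>
     (\<exists>S'. one_factor {0..<n} S' \<and> S' \<subseteq> G \<and> (\<forall>a b. (a, b) \<in> S \<longrightarrow> a \<notin> Domain M \<longrightarrow> (a, b) \<in> S') \<and>
        S\<^sup>* \<subseteq> S'\<^sup>* \<and> Q \<subseteq> S'\<^sup>*))"

lemma switchable_mono:
  assumes "switchable M Q" "M \<subseteq> M'"
  shows "switchable M' Q"
  unfolding switchable_def
proof (intro allI impI)
  fix S assume S: "one_factor {0..<n} S" "S \<subseteq> G" "M' \<subseteq> S"
  then have "M \<subseteq> S" using assms(2) by blast
  then obtain S' where "one_factor {0..<n} S'" "S' \<subseteq> G" "\<forall>a b. (a, b) \<in> S \<longrightarrow> a \<notin> Domain M \<longrightarrow> (a, b) \<in> S'"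
    "S\<^sup>* \<subseteq> S'\<^sup>*" "Q \<subseteq> S'\<^sup>*"
    using assms(1) S(1,2) unfolding switchable_def by blast
  moreover have "Domain M \<subseteq> Domain M'" using assms(2) by blast
  ultimately show "\<exists>S'. one_factor {0..<n} S' \<and> S' \<subseteq> G \<and> (\<forall>a b. (a, b) \<in> S \<longrightarrow> a \<notin> Domain M' \<longrightarrow> (a, b) \<in> S') \<and>
        S\<^sup>* \<subseteq> S'\<^sup>* \<and> Q \<subseteq> S'\<^sup>*" by (intro exI[of _ S']) blast
qed

text \<open>The old switches are applied first. If wire 0 (the path \<open>q1\<close>, reached from
  \<open>x\<close> through \<open>e\<close>) and the wire \<open>q2\<close> from \<open>s\<close> to
  \<open>t\<close> then lie on one cycle, nothing is changed; otherwise the new switch is exchanged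
  and merges their cycles. In both cases \<open>x\<close> and \<open>s\<close> end on a common cycle
  and earlier connections persist.\<close>

lemma switchable_step:
  assumes M: "switchable M Q"
    and M': "M \<union> edges q1 \<union> edges q2 \<subseteq> M'"
    and q1: "q1 = e # r1 @ u1 # w1 # r2 @ [u3, w3]"
    and q2: "q2 = s # r3 @ u2 # w2 # r4 @ u4 # w4 # r5 @ [t]"
    and dist: "distinct q1" "distinct q2" "set q1 \<inter> set q2 = {}"
    and dom: "set (butlast q1) \<inter> Domain M = {}" "set (butlast q2) \<inter> Domain M = {}"
    and new: "(u1, w2) \<in> G" "(u2, w3) \<in> G" "(u3, w4) \<in> G" "(u4, w1) \<in> G"
    and e: "(x, e) \<in> M\<^sup>*"
  shows "switchable M' (insert (x, s) Q)"
  unfolding switchable_def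
proof (intro allI impI)
  fix S assume S: "one_factor {0..<n} S" "S \<subseteq> G" "M' \<subseteq> S"
  then have "M \<subseteq> S" using M' by blast
  then obtain S' where S': "one_factor {0..<n} S'" "S' \<subseteq> G"
    and agree: "\<forall>a b. (a, b) \<in> S \<longrightarrow> a \<notin> Domain M \<longrightarrow> (a, b) \<in> S'" and "S\<^sup>* \<subseteq> S'\<^sup>*" "Q \<subseteq> S'\<^sup>*"
    using M S(1,2) unfolding switchable_def by blast
  \<comment> \<open>The arcs of the new wires start outside \<open>Domain M\<close>, so the old
    switches have not touched them.\<close>
  have qS: "edges q \<subseteq> S'" if "edges q \<subseteq> M'" "set (butlast q) \<inter> Domain M = {}" for q
  proof (rule subrelI)
    fix a b assume ab: "(a, b) \<in> edges q"
    then have "a \<in> set (butlast q)" using Domain_edges[of q] by blast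
    then have "a \<notin> Domain M" using that by blast
    then show "(a, b) \<in> S'" using ab agree that S(3) by blast
  qed
  have q1S: "edges q1 \<subseteq> S'" and q2S: "edges q2 \<subseteq> S'" using qS dom M' by blast+
  have segs: "edges (w1 # r2 @ [u3]) \<subseteq> S'" "edges (w2 # r4 @ [u4]) \<subseteq> S'"
    "(u1, w1) \<in> S'" "(u2, w2) \<in> S'" "(u3, w3) \<in> S'" "(u4, w4) \<in> S'"
    using q1S q2S by (simp_all add: q1 q2 edges_append_split)
  have "(x, e) \<in> S'\<^sup>*"
    using e \<open>M \<subseteq> S\<close> \<open>S\<^sup>* \<subseteq> S'\<^sup>*\<close> rtrancl_mono by blast
  moreover have "(e, u1) \<in> S'\<^sup>*"
    using edges_reach[of u1 e "tl q1"] q1S rtrancl_mono[OF q1S] by (auto simp: q1)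
  ultimately have xu1: "(x, u1) \<in> S'\<^sup>*" by simp
  have "(s, u2) \<in> S'\<^sup>*"
    using edges_reach[of u2 s "tl q2"] q2S rtrancl_mono[OF q2S] by (auto simp: q2)
  then have u2s: "(u2, s) \<in> S'\<^sup>*" using one_factor_rtrancl_sym[OF S'(1)] by simp
  have u: "{u1, u2, u3, u4} \<subseteq> Domain M'"
  proof -
    have "{u1, u3} \<subseteq> Domain (edges q1)" "{u2, u4} \<subseteq> Domain (edges q2)"
      unfolding Domain_edges by (auto simp: q1 q2 butlast_append)
    then show ?thesis using M' by blast
  qed
  have domM: "Domain M \<subseteq> Domain M'" using M' by blast
  show "\<exists>S'. one_factor {0..<n} S' \<and> S' \<subseteq> G \<and> (\<forall>a b. (a, b) \<in> S \<longrightarrow> a \<notin> Domain M' \<longrightarrow> (a, b) \<in> S') \<and>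
        S\<^sup>* \<subseteq> S'\<^sup>* \<and> insert (x, s) Q \<subseteq> S'\<^sup>*"
  proof (cases "(u1, u2) \<in> S'\<^sup>*")
    case True
    then have "(x, s) \<in> S'\<^sup>*" using xu1 u2s by (meson rtrancl_trans)
    then show ?thesis
      using S' agree domM \<open>S\<^sup>* \<subseteq> S'\<^sup>*\<close> \<open>Q \<subseteq> S'\<^sup>*\<close> by (intro exI[of _ S']) blast
  next
    case False
    define S'' where "S'' = {(a, b) \<in> S'. a \<notin> {u1, u2, u3, u4}} \<union> {(u1, w2), (u2, w3), (u3, w4), (u4, w1)}"
    have d: "distinct [u1, u2, u3, u4]" "set (w1 # r2) \<inter> {u1, u2, u3, u4} = {}"
      "set (w2 # r4) \<inter> {u1, u2, u3, u4} = {}"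
      using dist unfolding q1 q2 by auto
    note t = toggle[OF S'(1) _ d(1) segs(3-6) segs(1) d(2) segs(2) d(3) False, folded S''_def, simplified]
    have "(x, s) \<in> S''\<^sup>*" using xu1 u2s t by (meson rtrancl_trans subsetD)
    moreover have "S'' \<subseteq> G" using S' new by (auto simp: S''_def)
    moreover have "\<forall>a b. (a, b) \<in> S \<longrightarrow> a \<notin> Domain M' \<longrightarrow> (a, b) \<in> S''"
      using agree u domM by (auto simp: S''_def)
    ultimately show ?thesis
      using t \<open>S\<^sup>* \<subseteq> S'\<^sup>*\<close> \<open>Q \<subseteq> S'\<^sup>*\<close> by (intro exI[of _ S'']) auto
  qed
qed


text \<open>X and Y are the entries and exits of the structure: wire j runs from x j to y j, and z extra
  vertices are put on wire 0 to adjust the number of vertices. In stage i, the wires 1,...,i-1 are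
  finished and wire 0 runs from x 0 to e.\<close>

definition linkage where
  "linkage x y z i \<Gamma> M e \<longleftrightarrow>
     \<Gamma> \<subseteq> {0..<n} \<and> M \<subseteq> G \<and> one_one M \<and>
     x ` {..<m} \<union> y ` {..<m} \<subseteq> \<Gamma> \<and>
     Domain M = \<Gamma> - (y ` {..<m} \<union> x ` {i..<m} \<union> {e}) \<and>
     Range M = \<Gamma> - (x ` {..<m} \<union> y ` ({0} \<union> {i..<m})) \<and>
     e \<in> \<Gamma> - (y ` {..<m} \<union> x ` {i..<m}) \<and> (x 0, e) \<in> M\<^sup>* \<and>
     card \<Gamma> = 2 * m + z + 23 * (i - 1) \<and>
     (\<forall>v\<in>\<Gamma> - y ` ({0} \<union> {i..<m}). \<exists>j<m. (x j, v) \<in> M\<^sup>*) \<and>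
     switchable M ((\<lambda>j. (x 0, x j)) ` {..<i})"

text \<open>Bookkeeping for one stage: \<open>P1\<close> and \<open>P2\<close> are the new vertices
  on wires 0 and i, \<open>s\<close> is the entry of wire i, \<open>e\<close> the old and
  \<open>w\<close> the new end of wire 0. In the companion identity for ranges, \<open>t\<close> is
  the exit of wire i.\<close>

lemma linkage_domain_update:
  assumes "(P1 \<union> P2) \<inter> \<Gamma> = {}" "Y \<subseteq> \<Gamma>" "XS \<subseteq> \<Gamma>" "e \<in> \<Gamma>" "e \<notin> Y" "e \<notin> XS"
    "s \<in> \<Gamma>" "s \<notin> Y" "s \<notin> XS" "w \<in> P1" "w \<notin> P2"
  shows "(\<Gamma> - (Y \<union> insert s XS \<union> {e})) \<union> insert e (P1 - {w}) \<union> insert s P2 =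
    \<Gamma> \<union> (P1 \<union> P2) - (Y \<union> XS \<union> {w})"
  using assms by auto

lemma closing_update:
  assumes "a \<in> \<Gamma>" "a \<notin> Y" "R \<inter> Y = {}"
  shows "(\<Gamma> - (Y \<union> {a})) \<union> insert a R = (\<Gamma> \<union> R) - Y"
  using assms by auto

lemma linkage_range_update:
  assumes "(P1 \<union> P2) \<inter> \<Gamma> = {}" "X \<subseteq> \<Gamma>" "YS \<subseteq> \<Gamma>" "t \<in> \<Gamma>" "t \<notin> X" "t \<notin> YS"
  shows "(\<Gamma> - (X \<union> insert t YS)) \<union> P1 \<union> insert t P2 = \<Gamma> \<union> (P1 \<union> P2) - (X \<union> YS)"
  using assms by auto

text \<open>A stage uses 23 new vertices: the eight of the switch and three inner vertices on each
  of five connections, namely from \<open>e\<close> to u1, w1 to u3, \<open>x i\<close> to u2, w2 to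
  u4 and w4 to \<open>y i\<close>. The vertex w3 becomes the new end of wire 0.\<close>

lemma linkage_step:
  fixes x y :: "nat \<Rightarrow> nat"
  assumes inj: "inj_on x {..<m}" "inj_on y {..<m}" "x ` {..<m} \<inter> y ` {..<m} = {}"
    and z: "z < m" and i: "1 \<le> i" "i < m" and L: "linkage x y z i \<Gamma> M e"
  shows "\<exists>\<Gamma>' M' e'. linkage x y z (Suc i) \<Gamma>' M' e'"
proof -
  have \<Gamma>: "\<Gamma> \<subseteq> {0..<n}" and MG: "M \<subseteq> G" and oo: "one_one M"
    and XY: "x ` {..<m} \<subseteq> \<Gamma>" "y ` {..<m} \<subseteq> \<Gamma>"
    and dom: "Domain M = \<Gamma> - (y ` {..<m} \<union> x ` {i..<m} \<union> {e})"
    and ran: "Range M = \<Gamma> - (x ` {..<m} \<union> y ` ({0} \<union> {i..<m}))"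
    and e: "e \<in> \<Gamma>" "e \<notin> y ` {..<m}" "e \<notin> x ` {i..<m}" "(x 0, e) \<in> M\<^sup>*"
    and cd: "card \<Gamma> = 2 * m + z + 23 * (i - 1)"
    and reach: "\<And>v. v \<in> \<Gamma> \<Longrightarrow> v \<notin> y ` ({0} \<union> {i..<m}) \<Longrightarrow> \<exists>j<m. (x j, v) \<in> M\<^sup>*"
    and sw: "switchable M ((\<lambda>j. (x 0, x j)) ` {..<i})"
    using L unfolding linkage_def by auto
  have fin\<Gamma>: "finite \<Gamma>" using \<Gamma> finite_subset by blast
  have cd28: "card \<Gamma> + 23 \<le> 28 * m" using cd z i by linarith
  have im: "x i \<in> x ` {..<m}" "y i \<in> y ` {..<m}" "x i \<in> x ` {i..<m}" "y i \<in> y ` ({0} \<union> {i..<m})"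
    using i by auto
  have xi: "x i \<in> \<Gamma>" "x i < n" "x i \<notin> Domain M"
    using im subsetD[OF XY(1)] subsetD[OF \<Gamma>, of "x i"] dom by auto
  have yi: "y i \<in> \<Gamma>" "y i < n" "y i \<notin> Range M"
    using im subsetD[OF XY(2)] subsetD[OF \<Gamma>, of "y i"] ran by auto
  have en: "e < n" using e \<Gamma> by auto
  have xiyi: "x i \<noteq> y i" "e \<noteq> x i" "e \<noteq> y i"
    using im e inj(3) by (metis disjoint_iff)+
  have "30 * m \<le> n"
    using card_mono[OF _ Image_in_vertices(3), of "{e}"] out_large[OF en] by simp
  then have "card \<Gamma> < card {0..<n}" using cd28 m_pos by simp
  then obtain u1 where u1: "u1 < n" "u1 \<notin> \<Gamma>"
    using card_mono[OF fin\<Gamma>, of "{0..<n}"] by (metis atLeastLessThan_iff leD subsetI zero_le)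
  have c1: "card (insert u1 \<Gamma>) + 22 \<le> 28 * m" "finite (insert u1 \<Gamma>)" using u1 fin\<Gamma> cd28 by auto
  then have "card (insert u1 \<Gamma>) < card {0..<n}" using \<open>30 * m \<le> n\<close> m_pos by simp
  then obtain u3 where u3: "u3 < n" "u3 \<notin> insert u1 \<Gamma>"
    using card_mono[OF c1(2), of "{0..<n}"] by (metis atLeastLessThan_iff leD subsetI zero_le)
  \<comment> \<open>In the bounds for \<open>F2\<close> to \<open>F8\<close> the added constant is
    the number of the 23 vertices still to be chosen, so each forbidden set stays within 28
    m.\<close>
  define F2 where "F2 = insert u3 (insert u1 \<Gamma>)"
  have F2: "card F2 + 21 \<le> 28 * m" "finite F2" using u3 c1 by (auto simp: F2_def)
  \<comment> \<open>This antidirected path gives the wire arcs from u2 to w2 and from u3 to w3 and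
    the exchange arcs from u1 to w2 and from u2 to w3. The second one, through w1, u4 and w4, gives
    the other two arcs of each kind.\<close>
  then obtain w2 u2 w3 where g1: "distinct [w2, u2, w3]" "{w2, u2, w3} \<subseteq> {0..<n}" "{w2, u2, w3} \<inter> F2 = {}"
    "(u1, w2) \<in> G" "(u2, w2) \<in> G" "(u2, w3) \<in> G" "(u3, w3) \<in> G"
    using antidirected_connect[OF u1(1) u3(1) F2(2)] by auto
  define F3 where "F3 = {w2, u2, w3} \<union> F2"
  have F3: "card F3 + 18 \<le> 28 * m" "finite F3" using g1(1,3) F2 by (auto simp: F3_def)
  then obtain w1 u4 w4 where g2: "distinct [w1, u4, w4]" "{w1, u4, w4} \<subseteq> {0..<n}" "{w1, u4, w4} \<inter> F3 = {}"
    "(u1, w1) \<in> G" "(u4, w1) \<in> G" "(u4, w4) \<in> G" "(u3, w4) \<in> G"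
    using antidirected_connect[OF u1(1) u3(1) F3(2)] by auto
  define F4 where "F4 = {w1, u4, w4} \<union> F3"
  have F4: "card F4 + 15 \<le> 28 * m" "finite F4" using g2(1,3) F3 by (auto simp: F4_def)
  have step: "card (set r \<union> F) + k \<le> 28 * m \<and> finite (set r \<union> F)"
    if "length r = 3" "distinct r" "set r \<inter> F = {}" "card F + (k + 3) \<le> 28 * m" "finite F" for r F k
    using that by (simp add: card_Un_disjoint distinct_card)
  have lt: "u1 < n" "u2 < n" "u3 < n" "u4 < n" "w1 < n" "w2 < n" "w3 < n" "w4 < n"
    using u1 u3 g1 g2 by auto
  obtain r1 where r1: "length r1 = 3" "distinct r1" "set r1 \<subseteq> {0..<n}" "set r1 \<inter> F4 = {}" "edges (e # r1 @ [u1]) \<subseteq> G"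
    using connect[OF en lt(1) F4(2)] F4 by auto
  define F5 where "F5 = set r1 \<union> F4"
  have F5: "card F5 + 12 \<le> 28 * m" "finite F5" unfolding F5_def using step[OF r1(1,2,4), of 12] F4 by auto
  obtain r2 where r2: "length r2 = 3" "distinct r2" "set r2 \<subseteq> {0..<n}" "set r2 \<inter> F5 = {}" "edges (w1 # r2 @ [u3]) \<subseteq> G"
    using connect[OF lt(5) lt(3) F5(2)] F5 by auto
  define F6 where "F6 = set r2 \<union> F5"
  have F6: "card F6 + 9 \<le> 28 * m" "finite F6" unfolding F6_def using step[OF r2(1,2,4), of 9] F5 by auto
  obtain r3 where r3: "length r3 = 3" "distinct r3" "set r3 \<subseteq> {0..<n}" "set r3 \<inter> F6 = {}" "edges (x i # r3 @ [u2]) \<subseteq> G"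
    using connect[OF xi(2) lt(2) F6(2)] F6 by auto
  define F7 where "F7 = set r3 \<union> F6"
  have F7: "card F7 + 6 \<le> 28 * m" "finite F7" unfolding F7_def using step[OF r3(1,2,4), of 6] F6 by auto
  obtain r4 where r4: "length r4 = 3" "distinct r4" "set r4 \<subseteq> {0..<n}" "set r4 \<inter> F7 = {}" "edges (w2 # r4 @ [u4]) \<subseteq> G"
    using connect[OF lt(6) lt(4) F7(2)] F7 by auto
  define F8 where "F8 = set r4 \<union> F7"
  have F8: "card F8 + 3 \<le> 28 * m" "finite F8" unfolding F8_def using step[OF r4(1,2,4), of 3] F7 by auto
  obtain r5 where r5: "length r5 = 3" "distinct r5" "set r5 \<subseteq> {0..<n}" "set r5 \<inter> F8 = {}" "edges (w4 # r5 @ [y i]) \<subseteq> G"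
    using connect[OF lt(8) yi(2) F8(2)] F8 by auto
  note Fs = F8_def F7_def F6_def F5_def F4_def F3_def F2_def
  define p1 where "p1 = r1 @ u1 # w1 # r2 @ [u3, w3]"
  define p2 where "p2 = r3 @ u2 # w2 # r4 @ u4 # w4 # r5"
  define q1 where "q1 = e # p1"
  define q2 where "q2 = x i # p2 @ [y i]"
  have fresh: "distinct (p1 @ p2)" "set (p1 @ p2) \<inter> \<Gamma> = {}"
  proof -
    have N: "distinct [u1, u3, w2, u2, w3, w1, u4, w4]" "{u1, u3, w2, u2, w3, w1, u4, w4} \<inter> \<Gamma> = {}"
      using g1(1,3) g2(1,3) u1 u3 by (simp_all add: F2_def F3_def) metis+
    note r = r1(4) r2(4) r3(4) r4(4) r5(4)
    note r' = r[unfolded Fs, simplified Int_Un_distrib Un_empty disjoint_insert Int_empty_right]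
    show "distinct (p1 @ p2)"
      \<comment> \<open>The reversed list supplies each inequality in the opposite orientation to
        the simplifier.\<close>
      using N(1) N(1)[folded distinct_rev[of "[u1, u3, w2, u2, w3, w1, u4, w4]"]] r' r1(2) r2(2) r3(2) r4(2) r5(2)
      by (simp add: p1_def p2_def Int_Un_distrib Int_Un_distrib2 Int_commute)
    show "set (p1 @ p2) \<inter> \<Gamma> = {}"
      using N(2) r'
      by (simp add: p1_def p2_def Int_Un_distrib Int_Un_distrib2 Int_commute)
  qed
  have pn: "set (p1 @ p2) \<subseteq> {0..<n}"
    using r1(3) r2(3) r3(3) r4(3) r5(3) lt by (auto simp: p1_def p2_def)
  have qG: "edges q1 \<subseteq> G" "edges q2 \<subseteq> G"
    using r1(5) r2(5) r3(5) r4(5) r5(5) g1 g2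
    by (simp_all add: q1_def q2_def p1_def p2_def edges_append_split)
  have dq: "distinct q1" "distinct q2" "set q1 \<inter> set q2 = {}"
    using fresh e xi yi xiyi by (auto simp: q1_def q2_def)
  define \<Gamma>' where "\<Gamma>' = \<Gamma> \<union> set (p1 @ p2)"
  define M' where "M' = M \<union> edges q1 \<union> edges q2"
  have p1: "p1 \<noteq> []" "last p1 = w3" by (auto simp: p1_def)
  have b1: "set (butlast q1) = insert e (set p1 - {w3})"
  proof -
    have "butlast p1 = r1 @ u1 # w1 # r2 @ [u3]" by (simp add: p1_def butlast_append)
    moreover have "w3 \<notin> set (r1 @ u1 # w1 # r2 @ [u3])" using fresh by (auto simp: p1_def)
    ultimately show ?thesis using p1(1) by (auto simp: q1_def p1_def)
  qed
  have b2: "set (butlast q2) = insert (x i) (set p2)" by (simp add: q2_def butlast_append)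
  have t1: "set (tl q1) = set p1" and t2: "set (tl q2) = insert (y i) (set p2)" by (auto simp: q1_def q2_def)
  have w3: "w3 \<in> set p1" by (simp add: p1_def)
  have Dom': "Domain M' = Domain M \<union> insert e (set p1 - {w3}) \<union> insert (x i) (set p2)"
    by (simp add: M'_def Domain_Un_eq Domain_edges b1 b2)
  have Ran': "Range M' = Range M \<union> set p1 \<union> insert (y i) (set p2)"
    by (simp add: M'_def Range_Un_eq Range_edges t1 t2)
  have Mdom: "Domain M \<subseteq> \<Gamma>" "Range M \<subseteq> \<Gamma>" "e \<notin> Domain M" using dom ran by auto
  have one: "one_one M'"
    unfolding M'_def
  proof (intro one_one_Un oo one_one_edges dq(1,2))
    show "Domain M \<inter> Domain (edges q1) = {}" "Range M \<inter> Range (edges q1) = {}"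
      using fresh Mdom by (auto simp only: Domain_edges Range_edges b1 t1 set_append)
    show "Domain (M \<union> edges q1) \<inter> Domain (edges q2) = {}" "Range (M \<union> edges q1) \<inter> Range (edges q2) = {}"
      unfolding Domain_Un_eq Range_Un_eq Domain_edges Range_edges b1 b2 t1 t2
      using fresh Mdom xi yi xiyi e(1) by auto
  qed
  have split: "{i..<m} = insert i {Suc i..<m}" using i by auto
  have xsuc: "x i \<notin> x ` {Suc i..<m}" "y i \<notin> y ` ({0} \<union> {Suc i..<m})"
    using inj_on_eq_iff[OF inj(1)] inj_on_eq_iff[OF inj(2)] i by auto
  have ins: "x ` {i..<m} = insert (x i) (x ` {Suc i..<m})"
    "y ` ({0} \<union> {i..<m}) = insert (y i) (y ` ({0} \<union> {Suc i..<m}))"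
    unfolding split by auto
  have sub: "x ` {Suc i..<m} \<subseteq> x ` {..<m}" "y ` ({0} \<union> {Suc i..<m}) \<subseteq> y ` {..<m}"
    using i by auto
  have D: "Domain M' = \<Gamma>' - (y ` {..<m} \<union> x ` {Suc i..<m} \<union> {w3})"
    unfolding Dom' dom \<Gamma>'_def ins set_append
  proof (rule linkage_domain_update)
    show "x i \<notin> y ` {..<m}" using inj(3) im by blast
    show "e \<notin> x ` {Suc i..<m}" using e ins by blast
  qed (use fresh sub XY e xi xsuc w3 in auto)
  have R: "Range M' = \<Gamma>' - (x ` {..<m} \<union> y ` ({0} \<union> {Suc i..<m}))"
    unfolding Ran' ran \<Gamma>'_def ins set_append
  proof (rule linkage_range_update)
    show "y i \<notin> x ` {..<m}" using inj(3) im by blast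
    show "y ` ({0} \<union> {Suc i..<m}) \<subseteq> \<Gamma>" using sub XY by blast
  qed (use fresh XY yi xsuc in auto)
  have cd': "card \<Gamma>' = 2 * m + z + 23 * (Suc i - 1)"
  proof -
    have "card (set (p1 @ p2)) = 23"
      using distinct_card[OF fresh(1)] r1(1) r2(1) r3(1) r4(1) r5(1) by (simp add: p1_def p2_def)
    moreover have "card \<Gamma>' = card \<Gamma> + card (set (p1 @ p2))"
      unfolding \<Gamma>'_def using fresh fin\<Gamma> by (intro card_Un_disjoint) auto
    ultimately show ?thesis using cd i by simp
  qed
  have MM: "M\<^sup>* \<subseteq> M'\<^sup>*" "(edges q1)\<^sup>* \<subseteq> M'\<^sup>*" "(edges q2)\<^sup>* \<subseteq> M'\<^sup>*"
    by (auto simp: M'_def intro!: rtrancl_mono)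
  have r1': "(x 0, v) \<in> M'\<^sup>*" if "v \<in> set p1" for v
  proof -
    have "(e, v) \<in> (edges q1)\<^sup>*"
      unfolding q1_def using that by (intro edges_reach) auto
    then have "(e, v) \<in> M'\<^sup>*" using MM by blast
    moreover have "(x 0, e) \<in> M'\<^sup>*" using e MM by blast
    ultimately show ?thesis by (rule rtrancl_trans[rotated])
  qed
  have r2': "(x i, v) \<in> M'\<^sup>*" if "v \<in> set p2 \<or> v = y i" for v
  proof -
    have "(x i, v) \<in> (edges q2)\<^sup>*"
      unfolding q2_def using that by (intro edges_reach) auto
    then show ?thesis using MM by blast
  qed
  have reach': "\<exists>j<m. (x j, v) \<in> M'\<^sup>*" if "v \<in> \<Gamma>'" "v \<notin> y ` ({0} \<union> {Suc i..<m})" for v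
  proof (cases "v \<in> set p1 \<or> v \<in> set p2 \<or> v = y i")
    case True
    then show ?thesis using r1' r2' i m_pos by blast
  next
    case False
    then have "v \<in> \<Gamma>" "v \<notin> y ` ({0} \<union> {i..<m})" using that unfolding \<Gamma>'_def ins by auto
    then show ?thesis using reach MM by blast
  qed
  have sw': "switchable M' ((\<lambda>j. (x 0, x j)) ` {..<Suc i})"
  proof -
    have q12: "q1 = e # r1 @ u1 # w1 # r2 @ [u3, w3]" "q2 = x i # r3 @ u2 # w2 # r4 @ u4 # w4 # r5 @ [y i]"
      by (simp_all add: q1_def q2_def p1_def p2_def)
    have "set (butlast q1) \<inter> Domain M = {}" "set (butlast q2) \<inter> Domain M = {}"
      unfolding b1 b2 using fresh Mdom xi by auto
    from switchable_step[OF sw _ q12 dq this g1(4) g1(6) g2(7) g2(5) e(4), of M']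
    show ?thesis by (simp add: M'_def lessThan_Suc)
  qed
  have "linkage x y z (Suc i) \<Gamma>' M' w3"
    unfolding linkage_def
  proof (intro conjI)
    show "\<Gamma>' \<subseteq> {0..<n}" using \<Gamma> pn by (auto simp: \<Gamma>'_def)
    show "M' \<subseteq> G" using MG qG by (auto simp: M'_def)
    show "x ` {..<m} \<union> y ` {..<m} \<subseteq> \<Gamma>'" using XY unfolding \<Gamma>'_def by blast
    show "w3 \<in> \<Gamma>' - (y ` {..<m} \<union> x ` {Suc i..<m})"
    proof -
      have "w3 \<notin> \<Gamma>" using w3 fresh(2) by auto
      then have "w3 \<notin> y ` {..<m}" "w3 \<notin> x ` {Suc i..<m}" using XY sub(1) by blast+
      then show ?thesis using w3 by (simp add: \<Gamma>'_def)
    qed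
    show "\<forall>v\<in>\<Gamma>' - y ` ({0} \<union> {Suc i..<m}). \<exists>j<m. (x j, v) \<in> M'\<^sup>*" using reach' by blast
  qed (fact one D R cd' sw' r1'[OF w3])+
  then show ?thesis by blast
qed


lemma linkage_init:
  fixes x y :: "nat \<Rightarrow> nat"
  assumes inj: "inj_on x {..<m}" "inj_on y {..<m}" "x ` {..<m} \<inter> y ` {..<m} = {}"
    and V: "x ` {..<m} \<union> y ` {..<m} \<subseteq> {0..<n}" and z: "z < m"
  shows "\<exists>\<Gamma> M e. linkage x y z 1 \<Gamma> M e"
proof -
  define F where "F = x ` {..<m} \<union> y ` {..<m}"
  have F: "finite F" "card F = 2 * m"
    using inj unfolding F_def by (simp_all add: card_Un_disjoint card_image)
  have X: "x ` {..<m} = insert (x 0) (x ` {1..<m})" "y ` ({0} \<union> {1..<m}) = y ` {..<m}"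
  proof -
    have "{..<m} = insert 0 {1..<m}" using m_pos by auto
    then show "x ` {..<m} = insert (x 0) (x ` {1..<m})" "y ` ({0} \<union> {1..<m}) = y ` {..<m}" by auto
  qed
  have x0: "x 0 \<in> F" "x 0 < n" "x 0 \<notin> y ` {..<m}" "x 0 \<notin> x ` {1..<m}"
    using V X inj(3) inj_on_eq_iff[OF inj(1)] m_pos unfolding F_def by auto
  obtain r where r: "length r = z" "distinct r" "set r \<subseteq> {0..<n}" "set r \<inter> F = {}" "edges (x 0 # r) \<subseteq> G"
    using extend_path[OF x0(2) F(1), of z] F(2) z by auto
  define q where "q = x 0 # r"
  define e where "e = last q"
  have dq: "distinct q" using r x0 by (auto simp: q_def)
  have bq: "set (butlast q) = set q - {e}"
  proof -
    have "q = butlast q @ [e]" by (simp add: e_def q_def)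
    then have "distinct (butlast q @ [e])" "set q = insert e (set (butlast q))"
      using dq by (metis, metis Un_insert_right set_append list.simps(15) sup_bot.right_neutral empty_set)
    then show ?thesis by auto
  qed
  have eq: "e \<in> set q" by (auto simp: e_def q_def)
  then have e: "e = x 0 \<or> e \<in> set r" by (simp add: q_def)
  have sw: "switchable (edges q) ((\<lambda>j. (x 0, x j)) ` {..<1})"
    unfolding switchable_def by auto
  have "linkage x y z 1 (F \<union> set r) (edges q) e"
    unfolding linkage_def X(2)
  proof (intro conjI)
    show "F \<union> set r \<subseteq> {0..<n}" using V r unfolding F_def by blast
    show "edges q \<subseteq> G" using r by (simp add: q_def)
    show "one_one (edges q)" using dq by (rule one_one_edges)
    show "x ` {..<m} \<union> y ` {..<m} \<subseteq> F \<union> set r" unfolding F_def by blast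
    show "Domain (edges q) = F \<union> set r - (y ` {..<m} \<union> x ` {1..<m} \<union> {e})"
      unfolding Domain_edges bq using r(4) x0 X(1) unfolding F_def q_def by auto
    show "Range (edges q) = F \<union> set r - (x ` {..<m} \<union> y ` {..<m})"
      unfolding Range_edges using r(4) unfolding F_def q_def by auto
    show "e \<in> F \<union> set r - (y ` {..<m} \<union> x ` {1..<m})"
      using e x0 r(4) X(1) unfolding F_def by auto
    show "(x 0, e) \<in> (edges q)\<^sup>*" using eq unfolding q_def by (rule edges_reach)
    show "card (F \<union> set r) = 2 * m + z + 23 * (1 - 1)"
      using F r by (simp add: card_Un_disjoint Int_commute distinct_card)
    show "\<forall>v\<in>F \<union> set r - y ` {..<m}. \<exists>j<m. (x j, v) \<in> (edges q)\<^sup>*"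
    proof
      fix v assume v: "v \<in> F \<union> set r - y ` {..<m}"
      show "\<exists>j<m. (x j, v) \<in> (edges q)\<^sup>*"
      proof (cases "v \<in> set r")
        case True
        then have "(x 0, v) \<in> (edges q)\<^sup>*" unfolding q_def by (intro edges_reach) simp
        then show ?thesis using m_pos by blast
      next
        case False
        then have "v \<in> x ` {..<m}" using v unfolding F_def by blast
        then show ?thesis by auto
      qed
    qed
  qed (fact sw)
  then show ?thesis by blast
qed

text \<open>After m - 1 stages only the exit of wire 0 is still detached, and a last connection with
  three inner vertices leads to it. The count is 2 m + z + 23 (m - 1) + 3 = 25 m + z - 20, stated
  additively to avoid truncated subtraction.\<close>

lemma linkage_exists:
  fixes x y :: "nat \<Rightarrow> nat"
  assumes inj: "inj_on x {..<m}" "inj_on y {..<m}" "x ` {..<m} \<inter> y ` {..<m} = {}"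
    and V: "x ` {..<m} \<union> y ` {..<m} \<subseteq> {0..<n}" and z: "z < m"
  shows "\<exists>\<Gamma> M. \<Gamma> \<subseteq> {0..<n} \<and> M \<subseteq> G \<and> one_one M \<and> x ` {..<m} \<union> y ` {..<m} \<subseteq> \<Gamma> \<and>
     Domain M = \<Gamma> - y ` {..<m} \<and> Range M = \<Gamma> - x ` {..<m} \<and> card \<Gamma> + 20 = 25 * m + z \<and>
     (\<forall>v\<in>\<Gamma>. \<exists>j<m. (x j, v) \<in> M\<^sup>*) \<and> switchable M ((\<lambda>j. (x 0, x j)) ` {..<m})"
proof -
  have "\<exists>\<Gamma> M e. linkage x y z i \<Gamma> M e" if "1 \<le> i" "i \<le> m" for i
    using that
  proof (induction i rule: dec_induct)
    case base
    show ?case using linkage_init[OF inj V z] .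
  next
    case (step i)
    then obtain \<Gamma> M e where "linkage x y z i \<Gamma> M e" by auto
    then show ?case using linkage_step[OF inj z] step by simp
  qed
  from this[of m] obtain \<Gamma> M e where L: "linkage x y z m \<Gamma> M e" using m_pos by auto
  have \<Gamma>: "\<Gamma> \<subseteq> {0..<n}" and MG: "M \<subseteq> G" and oo: "one_one M"
    and XY: "x ` {..<m} \<union> y ` {..<m} \<subseteq> \<Gamma>"
    and dom: "Domain M = \<Gamma> - (y ` {..<m} \<union> {e})"
    and ran: "Range M = \<Gamma> - (x ` {..<m} \<union> {y 0})"
    and e: "e \<in> \<Gamma>" "e \<notin> y ` {..<m}" "(x 0, e) \<in> M\<^sup>*"
    and cd: "card \<Gamma> = 2 * m + z + 23 * (m - 1)"
    and reach: "\<And>v. v \<in> \<Gamma> \<Longrightarrow> v \<noteq> y 0 \<Longrightarrow> \<exists>j<m. (x j, v) \<in> M\<^sup>*"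
    and sw: "switchable M ((\<lambda>j. (x 0, x j)) ` {..<m})"
    using L unfolding linkage_def by auto
  have fin: "finite \<Gamma>" using \<Gamma> finite_subset by blast
  have y0: "y 0 \<in> y ` {..<m}" using m_pos by simp
  then have "y 0 \<in> \<Gamma>" using XY by blast
  then have y0': "y 0 \<in> \<Gamma>" "y 0 < n" "e < n" using \<Gamma> e(1) by auto
  have "y 0 \<notin> x ` {..<m}" "e \<noteq> y 0" using y0 inj(3) e(2) by blast+
  note y0' = y0' this
  have "card \<Gamma> \<le> 28 * m" using cd z by linarith
  then obtain r where r: "length r = 3" "distinct r" "set r \<subseteq> {0..<n}" "set r \<inter> \<Gamma> = {}" "edges (e # r @ [y 0]) \<subseteq> G"
    using connect[OF y0'(3,2) fin] by auto
  define q where "q = e # r @ [y 0]"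
  have dq: "distinct q" using r y0' e by (auto simp: q_def)
  have bq: "set (butlast q) = insert e (set r)" and tq: "set (tl q) = insert (y 0) (set r)"
    by (auto simp: q_def butlast_append)
  have "one_one (M \<union> edges q)"
  proof (intro one_one_Un oo one_one_edges dq)
    show "Domain M \<inter> Domain (edges q) = {}" unfolding Domain_edges bq dom using r(4) by auto
    show "Range M \<inter> Range (edges q) = {}" unfolding Range_edges tq ran using r(4) by auto
  qed
  moreover have "Domain (M \<union> edges q) = (\<Gamma> \<union> set r) - y ` {..<m}"
  proof -
    have "set r \<inter> y ` {..<m} = {}" using r(4) XY by blast
    with e(1,2) show ?thesis
      unfolding Domain_Un_eq Domain_edges bq dom by (rule closing_update)
  qed
  moreover have "Range (M \<union> edges q) = (\<Gamma> \<union> set r) - x ` {..<m}"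
  proof -
    have "set r \<inter> x ` {..<m} = {}" using r(4) XY by blast
    with y0'(1) \<open>y 0 \<notin> x ` {..<m}\<close> show ?thesis
      unfolding Range_Un_eq Range_edges tq ran by (rule closing_update)
  qed
  moreover have "card (\<Gamma> \<union> set r) + 20 = 25 * m + z"
    using fin r cd m_pos by (simp add: card_Un_disjoint Int_commute distinct_card)
  moreover have "\<exists>j<m. (x j, v) \<in> (M \<union> edges q)\<^sup>*" if "v \<in> \<Gamma> \<union> set r" for v
  proof -
    have mono: "M\<^sup>* \<subseteq> (M \<union> edges q)\<^sup>*" "(edges q)\<^sup>* \<subseteq> (M \<union> edges q)\<^sup>*" by (auto intro!: rtrancl_mono)
    show ?thesis
    proof (cases "v \<in> \<Gamma> \<and> v \<noteq> y 0")
      case True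
      then show ?thesis using reach mono by blast
    next
      case False
      then have "(e, v) \<in> (edges q)\<^sup>*" using that unfolding q_def by (intro edges_reach) auto
      then have "(x 0, v) \<in> (M \<union> edges q)\<^sup>*" using e(3) mono by (meson rtrancl_trans subsetD)
      then show ?thesis using m_pos by blast
    qed
  qed
  moreover have "switchable (M \<union> edges q) ((\<lambda>j. (x 0, x j)) ` {..<m})"
    using sw by (rule switchable_mono) blast
  moreover have "\<Gamma> \<union> set r \<subseteq> {0..<n}" "M \<union> edges q \<subseteq> G" using \<Gamma> r MG by (auto simp: q_def)
  moreover have "x ` {..<m} \<union> y ` {..<m} \<subseteq> \<Gamma> \<union> set r" using XY by blast
  ultimately show ?thesis
    by (intro exI[of _ "\<Gamma> \<union> set r"] exI[of _ "M \<union> edges q"]) blast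
qed

text \<open>The wires and the matchings between consecutive blocks form a 1-factor, to which
  \<open>switchable\<close> applies. Afterwards all entries lie on the cycle of \<open>x 0\<close>.
  Every vertex of \<open>\<Gamma>\<close> is on a wire from some entry, and every vertex of a block
  is reached from an exit through the matchings, so no second cycle remains.\<close>

lemma hamiltonian_from_linkage:
  fixes x y :: "nat \<Rightarrow> nat" and C :: "nat \<Rightarrow> nat set"
  assumes \<Gamma>: "\<Gamma> \<subseteq> {0..<n}" and M: "M \<subseteq> G" "one_one M" and XY: "x ` {..<m} \<union> y ` {..<m} \<subseteq> \<Gamma>"
    and dom: "Domain M = \<Gamma> - y ` {..<m}" and ran: "Range M = \<Gamma> - x ` {..<m}"
    and reach: "\<And>v. v \<in> \<Gamma> \<Longrightarrow> \<exists>j<m. (x j, v) \<in> M\<^sup>*"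
    and sw: "switchable M ((\<lambda>j. (x 0, x j)) ` {..<m})"
    and C: "C 0 = y ` {..<m}" "C (Suc k) = x ` {..<m}" "\<And>i j. i \<in> {1..k} \<Longrightarrow> j \<in> {1..k} \<Longrightarrow> i \<noteq> j \<Longrightarrow> C i \<inter> C j = {}" "(\<Union>i\<in>{1..k}. C i) = {0..<n} - \<Gamma>"
    and N: "\<And>i. i \<le> k \<Longrightarrow> N i \<subseteq> G" "\<And>i. i \<le> k \<Longrightarrow> one_one (N i)"
      "\<And>i. i \<le> k \<Longrightarrow> Domain (N i) = C i" "\<And>i. i \<le> k \<Longrightarrow> Range (N i) = C (Suc i)"
  shows "hamiltonian n G"
proof -
  define S where "S = M \<union> (\<Union>i\<in>{..k}. N i)"
  have C\<Gamma>: "C i \<inter> \<Gamma> = {}" if "1 \<le> i" "i \<le> k" for i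
    using C(4) that by auto
  have Cdisj: "i = j" if "a \<in> C i" "a \<in> C j" "i \<le> k" "j \<le> k" for i j a
  proof (cases "i = 0 \<or> j = 0")
    case True
    then show ?thesis using that C(1) C\<Gamma> XY by (metis One_nat_def Suc_leI Un_upper2 disjoint_iff gr0I subset_iff)
  next
    case False
    then show ?thesis using that C(3)[of i j] by auto
  qed
  have Cdisj': "i = j" if "a \<in> C (Suc i)" "a \<in> C (Suc j)" "i \<le> k" "j \<le> k" for i j a
  proof (cases "i = k \<or> j = k")
    case True
    then show ?thesis
      using that C(2) C\<Gamma>[of "Suc i"] C\<Gamma>[of "Suc j"] XY
      by (metis Un_upper1 disjoint_iff le_add1 le_antisym not_less_eq_eq plus_1_eq_Suc subset_iff)
  next
    case False
    then show ?thesis using that Cdisj[of a "Suc i" "Suc j"] by simp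
  qed
  have N\<Gamma>: "a \<notin> Domain M" if "a \<in> C i" "i \<le> k" for a i
    using that C(1) C\<Gamma>[of i] dom by (cases i) auto
  have N\<Gamma>': "a \<notin> Range M" if "a \<in> C (Suc i)" "i \<le> k" for a i
    using that C(2) C\<Gamma>[of "Suc i"] ran by (cases "i = k") auto
  have ND: "a \<in> C i" "b \<in> C (Suc i)" if "(a, b) \<in> N i" "i \<le> k" for a b i
    using that N(3,4) by blast+
  have SE: "thesis" if "(a, b) \<in> S" "(a, b) \<in> M \<Longrightarrow> thesis" "\<And>i. i \<le> k \<Longrightarrow> (a, b) \<in> N i \<Longrightarrow> thesis" for a b thesis
    using that by (auto simp: S_def)
  have one: "one_one S"
    unfolding one_one_def
  proof (intro conjI single_valuedI)
    fix a b c assume ab: "(a, b) \<in> S" and ac: "(a, c) \<in> S"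
    show "b = c"
    proof (rule SE[OF ab]; rule SE[OF ac])
      assume "(a, b) \<in> M" "(a, c) \<in> M"
      then show ?thesis using one_oneD(1)[OF M(2)] by blast
    next
      fix i assume "(a, b) \<in> M" "(a, c) \<in> N i" "i \<le> k"
      then show ?thesis using N\<Gamma> ND by blast
    next
      fix i assume "(a, c) \<in> M" "(a, b) \<in> N i" "i \<le> k"
      then show ?thesis using N\<Gamma> ND by blast
    next
      fix i j assume *: "(a, b) \<in> N i" "i \<le> k" "(a, c) \<in> N j" "j \<le> k"
      then have "i = j" using Cdisj ND by blast
      then show ?thesis using * one_oneD(1)[OF N(2)] by blast
    qed
  next
    fix b a c assume "(b, a) \<in> S\<inverse>" "(b, c) \<in> S\<inverse>"
    then have ab: "(a, b) \<in> S" and ac: "(c, b) \<in> S" by auto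
    show "a = c"
    proof (rule SE[OF ab]; rule SE[OF ac])
      assume "(a, b) \<in> M" "(c, b) \<in> M"
      then show ?thesis using one_oneD(2)[OF M(2)] by blast
    next
      fix i assume "(a, b) \<in> M" "(c, b) \<in> N i" "i \<le> k"
      then show ?thesis using N\<Gamma>' ND by blast
    next
      fix i assume "(c, b) \<in> M" "(a, b) \<in> N i" "i \<le> k"
      then show ?thesis using N\<Gamma>' ND by blast
    next
      fix i j assume *: "(a, b) \<in> N i" "i \<le> k" "(c, b) \<in> N j" "j \<le> k"
      then have "i = j" using Cdisj' ND by blast
      then show ?thesis using * one_oneD(2)[OF N(2)] by blast
    qed
  qed
  have cover: "(\<Gamma> - X) \<union> (X \<union> ({0..<n} - \<Gamma>)) = {0..<n}" if "X \<subseteq> \<Gamma>" for X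
    using that \<Gamma> by blast
  have DS: "Domain S = {0..<n}"
  proof -
    have "{..k} = insert 0 {1..k}" by auto
    then have "Domain S = (\<Gamma> - y ` {..<m}) \<union> (C 0 \<union> (\<Union>i\<in>{1..k}. C i))"
      using N(3) by (simp add: S_def Domain_Un_eq Domain_Union dom image_Union)
    then show ?thesis unfolding C(4) C(1) using cover XY by simp
  qed
  have RS: "Range S = {0..<n}"
  proof -
    have "Suc ` {..k} = insert (Suc k) {1..k}"
      by (auto simp: image_Suc_atMost)
    moreover have "(\<Union>i\<in>{..k}. C (Suc i)) = (\<Union>i\<in>Suc ` {..k}. C i)"
      by simp
    ultimately have "(\<Union>i\<in>{..k}. C (Suc i)) = C (Suc k) \<union> (\<Union>i\<in>{1..k}. C i)"
      by simp
    moreover have "Range S = (\<Gamma> - x ` {..<m}) \<union> (\<Union>i\<in>{..k}. C (Suc i))"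
      using N(4) by (simp add: S_def Range_Un_eq Range_Union ran image_Union)
    ultimately show ?thesis unfolding C(4) C(2) using cover XY by simp
  qed
  have S: "one_factor {0..<n} S" using one DS RS by (simp add: one_factor_def)
  have "S \<subseteq> G" using M N(1) by (auto simp: S_def)
  moreover have "M \<subseteq> S" by (auto simp: S_def)
  ultimately obtain S' where S': "one_factor {0..<n} S'" "S' \<subseteq> G" "S\<^sup>* \<subseteq> S'\<^sup>*" "(\<lambda>j. (x 0, x j)) ` {..<m} \<subseteq> S'\<^sup>*"
    using sw S unfolding switchable_def by blast
  have r\<Gamma>: "(x 0, v) \<in> S'\<^sup>*" if v\<Gamma>: "v \<in> \<Gamma>" for v
  proof -
    obtain j where j: "j < m" "(x j, v) \<in> M\<^sup>*" using reach[OF v\<Gamma>] by blast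
    then have "(x j, v) \<in> S'\<^sup>*" using \<open>M \<subseteq> S\<close> S'(3) rtrancl_mono by blast
    moreover have "(x 0, x j) \<in> S'\<^sup>*" using S'(4) j by blast
    ultimately show ?thesis by (rule rtrancl_trans[rotated])
  qed
  have rC: "(x 0, v) \<in> S'\<^sup>*" if "v \<in> C i" "i \<le> k" for v i
    using that
  proof (induction i arbitrary: v)
    case 0
    then have "v \<in> \<Gamma>" using C(1) XY by blast
    then show ?case by (rule r\<Gamma>)
  next
    case (Suc i)
    then obtain u where u: "(u, v) \<in> N i" using N(4)[of i] by auto
    then have "(x 0, u) \<in> S'\<^sup>*" using Suc ND by (meson Suc_leD)
    moreover have "(u, v) \<in> S" using u Suc.prems by (auto simp: S_def)
    ultimately show ?case using S'(3) by (meson r_into_rtrancl rtrancl_trans subsetD)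
  qed
  have all: "(x 0, v) \<in> S'\<^sup>*" if "v < n" for v
  proof (cases "v \<in> \<Gamma>")
    case False
    then have "v \<in> (\<Union>i\<in>{1..k}. C i)" using that C(4) by simp
    then show ?thesis using rC by auto
  qed (rule r\<Gamma>)
  have "x 0 \<in> x ` {..<m}" using m_pos by simp
  then have "x 0 \<in> {0..<n}" using XY \<Gamma> by blast
  then have n: "0 < n" by simp
  show ?thesis
  proof (rule one_factor_hamiltonian[OF S'(1,2) n])
    fix v assume "v < n"
    then show "(0, v) \<in> S'\<^sup>*"
      using all[OF n] all[of v] one_factor_rtrancl_sym[OF S'(1)] by (meson finite_atLeastLessThan rtrancl_trans)
  qed
qed

end

section \<open>Matchings and balanced partitions\<close>

text \<open>Induction as in the proof of Halmos and Vaughan. A tight nonempty proper subset splits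
  the problem into two smaller ones; if there is none, every nonempty proper subset has a neighbour
  to spare, so an arbitrary pair can be matched and removed.\<close>

lemma hall_marriage:
  fixes E :: "('a \<times> 'b) set"
  assumes "finite A" "\<And>a. a \<in> A \<Longrightarrow> finite (E `` {a})" "\<And>S. S \<subseteq> A \<Longrightarrow> card S \<le> card (E `` S)"
  shows "\<exists>f. inj_on f A \<and> (\<forall>a\<in>A. (a, f a) \<in> E)"
  using assms
proof (induction "card A" arbitrary: A E rule: less_induct)
  case less
  have finI: "finite (E `` S)" if "S \<subseteq> A" for S
  proof -
    have "E `` S = (\<Union>a\<in>S. E `` {a})" by auto
    moreover have "finite (\<Union>a\<in>S. E `` {a})"
      using finite_subset[OF that less.prems(1)] less.prems(2) that by (intro finite_UN_I) blast+
    ultimately show ?thesis by simp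
  qed
  show ?case
  proof (cases "\<exists>S. S \<subset> A \<and> S \<noteq> {} \<and> card (E `` S) = card S")
    case True
    then obtain S where S: "S \<subset> A" "S \<noteq> {}" "card (E `` S) = card S" by blast
    have finS: "finite S" using S less.prems(1) by (meson finite_subset psubset_imp_subset)
    have "card S < card A" using S less.prems(1) by (simp add: psubset_card_mono)
    then have "\<exists>f. inj_on f S \<and> (\<forall>a\<in>S. (a, f a) \<in> E)"
      using S finS less.prems by (intro less.hyps) auto
    then obtain f where f: "inj_on f S" "\<And>a. a \<in> S \<Longrightarrow> (a, f a) \<in> E" by blast
    define E' where "E' = {(a, b) \<in> E. b \<notin> E `` S}"
    have "\<exists>g. inj_on g (A - S) \<and> (\<forall>a\<in>A - S. (a, g a) \<in> E')"
    proof (rule less.hyps)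
      show "card (A - S) < card A" using S less.prems(1) finS
        by (metis Diff_subset card_mono card_0_eq card_Diff_subset diff_less finite_subset le_0_eq neq0_conv psubset_imp_subset)
      show "finite (E' `` {a})" if "a \<in> A - S" for a
        using less.prems(2)[of a] that by (rule_tac finite_subset[of _ "E `` {a}"]) (auto simp: E'_def)
      show "card T \<le> card (E' `` T)" if T: "T \<subseteq> A - S" for T
      proof -
        have "finite T" using T less.prems(1) finite_subset by blast
        then have "card S + card T = card (S \<union> T)"
          using T finS by (subst card_Un_disjoint) auto
        also have "\<dots> \<le> card (E `` (S \<union> T))" using T S by (intro less.prems(3)) auto
        also have "E `` (S \<union> T) = E `` S \<union> E' `` T" by (auto simp: E'_def)
        also have "card \<dots> \<le> card (E `` S) + card (E' `` T)" by (rule card_Un_le)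
        finally show ?thesis using S by simp
      qed
    qed (use less.prems in simp)
    then obtain g where g: "inj_on g (A - S)" "\<And>a. a \<in> A - S \<Longrightarrow> (a, g a) \<in> E'" by blast
    define h where "h a = (if a \<in> S then f a else g a)" for a
    have "f a \<noteq> g b" if "a \<in> S" "b \<in> A - S" for a b
      using f(2)[OF that(1)] g(2)[OF that(2)] that(1) by (auto simp: E'_def)
    then have "inj_on h A"
      using f(1) g(1) unfolding inj_on_def h_def by (metis DiffI)
    moreover have "(a, h a) \<in> E" if "a \<in> A" for a
      using f(2)[of a] g(2)[of a] that by (auto simp: h_def E'_def)
    ultimately show ?thesis by blast
  next
    case tight: False
    show ?thesis
    proof (cases "A = {}")
      case False
      then obtain a where a: "a \<in> A" by blast
      have "card {a} \<le> card (E `` {a})" using a by (intro less.prems(3)) auto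
      then have "E `` {a} \<noteq> {}" by auto
      then obtain b where b: "(a, b) \<in> E" by blast
      define E' where "E' = {(c, d) \<in> E. d \<noteq> b}"
      have "\<exists>g. inj_on g (A - {a}) \<and> (\<forall>c\<in>A - {a}. (c, g c) \<in> E')"
      proof (rule less.hyps)
        show "card (A - {a}) < card A" using a less.prems(1) by (meson card_Diff1_less)
        show "finite (E' `` {c})" if "c \<in> A - {a}" for c
          using less.prems(2)[of c] that by (rule_tac finite_subset[of _ "E `` {c}"]) (auto simp: E'_def)
        show "card T \<le> card (E' `` T)" if T: "T \<subseteq> A - {a}" for T
        proof (cases "T = {}")
          case False
          have "T \<subset> A" using T a by blast
          have "card (E `` T) \<noteq> card T" using tight False \<open>T \<subset> A\<close> by meson
          moreover have "card T \<le> card (E `` T)" using \<open>T \<subset> A\<close> by (intro less.prems(3)) blast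
          moreover have "card (E `` T) - 1 \<le> card (E' `` T)"
          proof -
            have sub: "E `` T \<subseteq> insert b (E' `` T)" by (auto simp: E'_def)
            have "E' \<subseteq> E" by (auto simp: E'_def)
            then have "E' `` T \<subseteq> E `` T" by (rule Image_mono) simp
            moreover have "finite (E `` T)" using T by (intro finI) auto
            ultimately have f: "finite (E' `` T)" by (rule finite_subset)
            have "card (E `` T) \<le> card (insert b (E' `` T))"
              by (intro card_mono finite.insertI f sub)
            also have "\<dots> \<le> Suc (card (E' `` T))" using f by (simp add: card_insert_if)
            finally show ?thesis by simp
          qed
          ultimately show ?thesis by simp
        qed simp
      qed (use less.prems in simp)
      then obtain g where g: "inj_on g (A - {a})" "\<And>c. c \<in> A - {a} \<Longrightarrow> (c, g c) \<in> E'" by blast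
      have ne: "g c \<noteq> b" if "c \<in> A - {a}" for c using g(2)[OF that] by (auto simp: E'_def)
      have "inj_on (g(a := b)) A"
      proof (rule inj_onI)
        fix c d assume "c \<in> A" "d \<in> A" "(g(a := b)) c = (g(a := b)) d"
        then show "c = d"
          using ne[of c] ne[of d] inj_onD[OF g(1), of c d] by (auto split: if_splits)
      qed
      moreover have "(c, (g(a := b)) c) \<in> E" if "c \<in> A" for c
        using g(2)[of c] b that by (auto simp: E'_def)
      ultimately show ?thesis by blast
    qed simp
  qed
qed

section \<open>Perfect matchings from degree and sparsity conditions\<close>

lemma card_arcs_between:
  assumes "finite S" "finite T"
  shows "card (E \<inter> S \<times> T) = (\<Sum>a\<in>S. card (E `` {a} \<inter> T))"
    and "card (E \<inter> S \<times> T) = (\<Sum>b\<in>T. card (E\<inverse> `` {b} \<inter> S))"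
proof -
  have "E \<inter> S \<times> T = (SIGMA a:S. E `` {a} \<inter> T)" by auto
  then show "card (E \<inter> S \<times> T) = (\<Sum>a\<in>S. card (E `` {a} \<inter> T))"
    using assms by simp
  have "bij_betw prod.swap (E \<inter> S \<times> T) (SIGMA b:T. E\<inverse> `` {b} \<inter> S)"
    by (rule bij_betwI[where g = prod.swap]) auto
  then show "card (E \<inter> S \<times> T) = (\<Sum>b\<in>T. card (E\<inverse> `` {b} \<inter> S))"
    using assms by (simp add: bij_betw_same_card)
qed

text \<open>A set violating Hall's condition confines all arcs at some set of s vertices to at most
  s vertices on the other side. The degree bound makes at least \<delta> s such arcs, against
  \<open>sparse\<close>. Passing to the complement on the other side when the violating set is large
  keeps s at most (m + 1) / 2.\<close>

lemma perfect_matching: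
  fixes E :: "('a \<times> 'a) set" and \<delta> :: real
  assumes fin: "finite A" "finite B" and cA: "card A = m" and cB: "card B = m"
    and degA: "\<And>a. a \<in> A \<Longrightarrow> \<delta> \<le> card (E `` {a} \<inter> B)"
    and degB: "\<And>b. b \<in> B \<Longrightarrow> \<delta> \<le> card (E\<inverse> `` {b} \<inter> A)"
    and sparse: "\<And>S T s. S \<subseteq> A \<Longrightarrow> T \<subseteq> B \<Longrightarrow> card S \<le> s \<Longrightarrow> card T \<le> s \<Longrightarrow> 0 < s \<Longrightarrow> 2 * s \<le> m + 1 \<Longrightarrow>
      card (E \<inter> S \<times> T) < \<delta> * s"
  obtains N where "N \<subseteq> E" "one_one N" "Domain N = A" "Range N = B"
proof -
  define E' where "E' = E \<inter> A \<times> B"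
  have "\<exists>f. inj_on f A \<and> (\<forall>a\<in>A. (a, f a) \<in> E')"
  proof (rule hall_marriage[OF fin(1)])
    show "finite (E' `` {a})" for a using fin(2) by (rule finite_subset[rotated]) (auto simp: E'_def)
    fix S assume S: "S \<subseteq> A"
    have finS: "finite S" using S fin finite_subset by blast
    show "card S \<le> card (E' `` S)"
    proof (rule ccontr)
      assume "\<not> card S \<le> card (E' `` S)"
      then have less: "card (E' `` S) < card S" by simp
      have NS: "E' `` S \<subseteq> B" by (auto simp: E'_def)
      then have finN: "finite (E' `` S)" using fin finite_subset by blast
      show False
      proof (cases "2 * card S \<le> m + 1")
        case True
        have "real (card S) * \<delta> \<le> (\<Sum>a\<in>S. real (card (E `` {a} \<inter> B)))"
          using degA S by (intro sum_bounded_below) auto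
        also have "\<dots> = (\<Sum>a\<in>S. real (card (E `` {a} \<inter> E' `` S)))"
          using S by (intro sum.cong refl arg_cong[where f = "\<lambda>X. real (card X)"]) (auto simp: E'_def)
        also have "\<dots> = card (E \<inter> S \<times> (E' `` S))"
          using card_arcs_between(1)[OF finS finN, of E] by simp
        also have "\<dots> < \<delta> * card S"
          using less True by (intro sparse[OF S NS]) auto
        finally show False by (simp add: mult.commute)
      next
        case False
        have "card S \<le> m" using S cA fin card_mono by blast
        have "card (B - E' `` S) = m - card (E' `` S)" using NS cB finN by (simp add: card_Diff_subset)
        then have "m - card S + 1 \<le> card (B - E' `` S)" using less \<open>card S \<le> m\<close> by simp
        \<comment> \<open>All in-neighbours of \<open>T\<close> within \<open>A\<close> lie in
          \<open>A - S\<close>, which has one element less than \<open>T\<close>. From 2 card S > m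
          + 1 it follows that 2 card T \<le> m, so \<open>sparse\<close> applies with s = card
          T.\<close>
        then obtain T where T: "T \<subseteq> B - E' `` S" "card T = m - card S + 1" "finite T"
          by (rule obtain_subset_with_card_n)
        have AS: "card (A - S) = m - card S" using S cA finS by (simp add: card_Diff_subset)
        have "real (card T) * \<delta> \<le> (\<Sum>b\<in>T. real (card (E\<inverse> `` {b} \<inter> A)))"
          using degB T by (intro sum_bounded_below) auto
        also have "\<dots> = (\<Sum>b\<in>T. real (card (E\<inverse> `` {b} \<inter> (A - S))))"
          using T S by (intro sum.cong refl arg_cong[where f = "\<lambda>X. real (card X)"]) (auto simp: E'_def)
        also have "\<dots> = card (E \<inter> (A - S) \<times> T)"
          using card_arcs_between(2)[of "A - S" T E] fin T by simp
        also have "\<dots> < \<delta> * card T"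
          using T AS False \<open>card S \<le> m\<close> by (intro sparse) auto
        finally show False by (simp add: mult.commute)
      qed
    qed
  qed
  then obtain f where f: "inj_on f A" "\<And>a. a \<in> A \<Longrightarrow> (a, f a) \<in> E'" by blast
  define N where "N = (\<lambda>a. (a, f a)) ` A"
  have "f ` A \<subseteq> B" using f(2) by (auto simp: E'_def)
  then have "f ` A = B" using f(1) cA cB fin(2) by (metis card_image card_subset_eq)
  then have "Range N = B" by (auto simp: N_def)
  moreover have "Domain N = A" "N \<subseteq> E" using f(2) by (auto simp: N_def E'_def)
  moreover have "one_one N"
    using f(1) by (auto simp: N_def one_one_def single_valued_def inj_on_def)
  ultimately show thesis using that by blast
qed

section \<open>Equal parts from random cyclic shifts\<close>

lemma bij_betw_add_mod:
  fixes i k :: nat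
  assumes "0 < k"
  shows "bij_betw (\<lambda>j. (i + j) mod k) {..<k} {..<k}"
proof -
  have "inj_on (\<lambda>j. (i + j) mod k) {..<k}"
  proof (rule inj_onI)
    fix j j' assume j: "j \<in> {..<k}" "j' \<in> {..<k}" "(i + j) mod k = (i + j') mod k"
    then obtain q1 q2 where "i + j + k * q1 = i + j' + k * q2" by (auto simp: nat_mod_eq_iff)
    then have "j + k * q1 = j' + k * q2" by simp
    then have "j mod k = j' mod k" by (auto simp: nat_mod_eq_iff)
    then show "j = j'" using j by simp
  qed
  moreover have "(\<lambda>j. (i + j) mod k) ` {..<k} \<subseteq> {..<k}" using assms by auto
  ultimately show ?thesis by (simp add: bij_betw_def endo_inj_surj)
qed

text \<open>Arrange W in m columns of k elements, shift each column cyclically by an independent uniform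
  amount, and let the parts be the rows: all parts have exactly m elements, and the size of the
  intersection of a row with N is a sum of independent indicators.\<close>

lemma balanced_partition:
  fixes W :: "'a set" and \<N> :: "'a set set" and y \<mu> L :: real
  assumes W: "finite W" "card W = k * m" and k: "0 < k" and fin: "finite \<N>" and y: "0 < y" "y < 1"
    and \<mu>: "\<And>N. N \<in> \<N> \<Longrightarrow> \<mu> * k \<le> card (N \<inter> W)"
    and bound: "card \<N> * k * (exp (- y * \<mu>) * (1 - y) powr (- L)) < 1"
  obtains V :: "nat \<Rightarrow> 'a set" where "\<And>i. i < k \<Longrightarrow> card (V i) = m" "(\<Union>i\<in>{..<k}. V i) = W"
    "\<And>i j. i < k \<Longrightarrow> j < k \<Longrightarrow> i \<noteq> j \<Longrightarrow> V i \<inter> V j = {}"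
    "\<And>i N. i < k \<Longrightarrow> N \<in> \<N> \<Longrightarrow> L \<le> card (N \<inter> V i)"
proof -
  have "card ({..<m} \<times> {..<k}) = card W" using W by simp
  then obtain e where e: "bij_betw e ({..<m} \<times> {..<k}) W"
    using W(1) by (meson finite_SigmaI finite_lessThan finite_same_card_bij)
  define P where "P = ({..<m} \<rightarrow>\<^sub>E {..<k})"
  define V where "V s i = (\<lambda>c. e (c, (i + s c) mod k)) ` {..<m}" for s i
  have finP: "finite P" unfolding P_def by (intro finite_PiE) auto
  have cardP: "card P = k ^ m" unfolding P_def by (simp add: card_PiE)
  have eeq: "e (c, j) = e (c', j') \<longleftrightarrow> c = c' \<and> j = j'" if "c < m" "c' < m" "j < k" "j' < k" for c c' j j'
    using inj_on_eq_iff[OF bij_betw_imp_inj_on[OF e]] that by auto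
  have injc: "inj_on (\<lambda>c. e (c, (i + s c) mod k)) {..<m}" for s i
    using k by (intro inj_onI) (simp add: eeq)
  \<comment> \<open>This is the exponential moment of the intersection size, multiplied by the
    number \<open>k ^ m\<close> of shift vectors. It factors over the columns because their shifts
    are independent.\<close>
  have main: "(\<Sum>s\<in>P. (1 - y) ^ card (N \<inter> V s i)) \<le> k ^ m * exp (- y * \<mu>)"
    if N: "N \<in> \<N>" and i: "i < k" for N i
  proof -
    define g where "g c j = (if e (c, j) \<in> N then 1 - y else 1)" for c j
    define h where "h c = card {j. j < k \<and> e (c, j) \<in> N}" for c
    have "(1 - y) ^ card (N \<inter> V s i) = (\<Prod>c<m. g c ((i + s c) mod k))" for s
    proof -
      have "N \<inter> V s i = (\<lambda>c. e (c, (i + s c) mod k)) ` {c \<in> {..<m}. e (c, (i + s c) mod k) \<in> N}"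
        by (auto simp: V_def)
      then have "card (N \<inter> V s i) = card {c \<in> {..<m}. e (c, (i + s c) mod k) \<in> N}"
        by (simp only:) (intro card_image inj_on_subset[OF injc], auto)
      then show ?thesis
        unfolding g_def by (simp add: prod.If_cases Int_def)
    qed
    then have "(\<Sum>s\<in>P. (1 - y) ^ card (N \<inter> V s i)) = (\<Sum>s\<in>P. \<Prod>c<m. g c ((i + s c) mod k))"
      by simp
    also have "\<dots> = (\<Prod>c<m. \<Sum>j<k. g c ((i + j) mod k))"
      unfolding P_def by (subst prod_sum_PiE) auto
    also have "\<dots> = (\<Prod>c<m. \<Sum>j<k. g c j)"
      by (intro prod.cong refl sum.reindex_bij_betw bij_betw_add_mod k)
    also have "\<dots> = (\<Prod>c<m. k - y * h c)"
    proof (intro prod.cong refl)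
      fix c
      have "(\<Sum>j<k. g c j) = (\<Sum>j<k. 1 - y * (if e (c, j) \<in> N then 1 else 0))"
        by (intro sum.cong) (auto simp: g_def)
      also have "\<dots> = k - y * (\<Sum>j<k. if e (c, j) \<in> N then 1 else 0)"
        by (simp add: sum_subtractf sum_distrib_left)
      also have "(\<Sum>j<k. if e (c, j) \<in> N then 1 else (0::real)) = h c"
        by (simp add: h_def sum.If_cases Int_def)
      finally show "(\<Sum>j<k. g c j) = k - y * h c" .
    qed
    also have "\<dots> \<le> (\<Prod>c<m. k * exp (- y * h c / k))"
    proof (intro prod_mono conjI)
      fix c
      have "h c \<le> card {..<k}" unfolding h_def by (intro card_mono) auto
      then have "y * h c \<le> 1 * real k" using y by (intro mult_mono) auto
      then show "0 \<le> k - y * h c" by simp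
      have "k - y * h c = k * (1 + (- y * h c / k))" using k by (simp add: field_simps)
      also have "\<dots> \<le> k * exp (- y * h c / k)" by (intro mult_left_mono exp_ge_add_one_self) auto
      finally show "k - y * h c \<le> k * exp (- y * h c / k)" .
    qed
    also have "\<dots> = k ^ m * exp (\<Sum>c<m. - y * h c / k)"
      by (simp add: prod.distrib exp_sum)
    also have "(\<Sum>c<m. - y * h c / k) = - (y * (\<Sum>c<m. h c) / k)"
      by (simp add: sum_negf sum_divide_distrib sum_distrib_left)
    also have "(\<Sum>c<m. h c) = card (N \<inter> W)"
    proof -
      have "bij_betw e (SIGMA c:{..<m}. {j. j < k \<and> e (c, j) \<in> N}) (N \<inter> W)"
        using e unfolding bij_betw_def inj_on_def by (auto simp: image_iff)
      then show ?thesis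
        by (simp add: bij_betw_same_card[symmetric] h_def)
    qed
    also have "k ^ m * exp (- (y * card (N \<inter> W) / k)) \<le> k ^ m * exp (- y * \<mu>)"
    proof -
      have "\<mu> \<le> card (N \<inter> W) / k" using \<mu>[OF N] k by (simp add: field_simps)
      then have "y * \<mu> \<le> y * (card (N \<inter> W) / k)" using y by (intro mult_left_mono) auto
      then show ?thesis by (intro mult_left_mono) auto
    qed
    finally show ?thesis .
  qed
  \<comment> \<open>Markov's inequality for powers of 1 - y. As the base is below 1, a small
    intersection makes the power large.\<close>
  have bad: "card {s \<in> P. card (N \<inter> V s i) < L} \<le> k ^ m * (exp (- y * \<mu>) * (1 - y) powr (- L))"
    if "N \<in> \<N>" "i < k" for N i
  proof -
    let ?B = "{s \<in> P. card (N \<inter> V s i) < L}"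
    have "card ?B * (1 - y) powr L = (\<Sum>s\<in>?B. (1 - y) powr L)" by simp
    also have "\<dots> \<le> (\<Sum>s\<in>?B. (1 - y) ^ card (N \<inter> V s i))"
    proof (rule sum_mono)
      fix s assume "s \<in> ?B"
      then have "(1 - y) powr L \<le> (1 - y) powr (card (N \<inter> V s i))"
        using y by (intro powr_mono') auto
      then show "(1 - y) powr L \<le> (1 - y) ^ card (N \<inter> V s i)" using y by (simp add: powr_realpow)
    qed
    also have "\<dots> \<le> (\<Sum>s\<in>P. (1 - y) ^ card (N \<inter> V s i))"
      using finP y by (intro sum_mono2) auto
    also have "\<dots> \<le> k ^ m * exp (- y * \<mu>)" by (rule main[OF that])
    finally have "card ?B * (1 - y) powr L * (1 - y) powr (- L) \<le> k ^ m * exp (- y * \<mu>) * (1 - y) powr (- L)"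
      by (intro mult_right_mono) auto
    moreover have "(1 - y) powr L * (1 - y) powr (- L) = 1"
      using y by (simp flip: powr_add)
    ultimately show ?thesis by (simp add: mult.assoc)
  qed
  define Bad where "Bad = (\<Union>(N, i)\<in>\<N> \<times> {..<k}. {s \<in> P. card (N \<inter> V s i) < L})"
  have "card Bad \<le> (\<Sum>(N, i)\<in>\<N> \<times> {..<k}. card {s \<in> P. card (N \<inter> V s i) < L})"
    unfolding Bad_def using card_UN_le[of "\<N> \<times> {..<k}" "\<lambda>(N, i). {s \<in> P. card (N \<inter> V s i) < L}"] fin
    by (simp add: case_prod_unfold)
  then have "real (card Bad) \<le> (\<Sum>(N, i)\<in>\<N> \<times> {..<k}. real (card {s \<in> P. card (N \<inter> V s i) < L}))"
    by (simp add: case_prod_unfold flip: of_nat_sum)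
  also have "\<dots> \<le> (\<Sum>(N, i)\<in>\<N> \<times> {..<k}. k ^ m * (exp (- y * \<mu>) * (1 - y) powr (- L)))"
    using bad by (intro sum_mono) auto
  also have "\<dots> = k ^ m * (card \<N> * k * (exp (- y * \<mu>) * (1 - y) powr (- L)))"
    by (simp add: card_cartesian_product)
  also have "\<dots> < k ^ m * 1" using mult_strict_left_mono[OF bound, of "real (k ^ m)"] k by simp
  finally have "card Bad < card P" by (simp add: cardP flip: of_nat_power)
  then have "\<not> P \<subseteq> Bad"
    using finP card_mono[of Bad P] by (auto simp: Bad_def intro: finite_subset[of _ P])
  then obtain s where s: "s \<in> P" "s \<notin> Bad" by blast
  have sk: "s c < k" if "c < m" for c using s(1) that by (auto simp: P_def PiE_iff)
  show thesis
  proof (rule that[of "V s"])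
    show "card (V s i) = m" for i unfolding V_def by (simp add: card_image injc)
    show "V s i \<inter> V s j = {}" if "i < k" "j < k" "i \<noteq> j" for i j
    proof -
      have "i = j" if "c < m" "(i + s c) mod k = (j + s c) mod k" for c
        using inj_on_eq_iff[OF bij_betw_imp_inj_on[OF bij_betw_add_mod[OF k, of "s c"]], of i j] that \<open>i < k\<close> \<open>j < k\<close>
        by (simp add: add.commute)
      then show ?thesis using that(3) k by (auto simp: V_def eeq)
    qed
    show "(\<Union>i\<in>{..<k}. V s i) = W"
    proof
      show "(\<Union>i\<in>{..<k}. V s i) \<subseteq> W"
        using bij_betw_imp_surj_on[OF e] k by (auto simp: V_def)
      show "W \<subseteq> (\<Union>i\<in>{..<k}. V s i)"
      proof
        fix w assume "w \<in> W"
        then have "w \<in> e ` ({..<m} \<times> {..<k})" using bij_betw_imp_surj_on[OF e] by simp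
        then obtain c j where cj: "c < m" "j < k" "w = e (c, j)" by auto
        have "j \<in> (\<lambda>i. (s c + i) mod k) ` {..<k}"
          using bij_betw_imp_surj_on[OF bij_betw_add_mod[OF k, of "s c"]] cj by simp
        then obtain i where "i < k" "j = (i + s c) mod k" by (auto simp: add.commute)
        then show "w \<in> (\<Union>i\<in>{..<k}. V s i)" using cj by (auto simp: V_def)
      qed
    qed
    show "L \<le> card (N \<inter> V s i)" if "i < k" "N \<in> \<N>" for i N
    proof (rule ccontr)
      assume "\<not> L \<le> card (N \<inter> V s i)"
      then have "s \<in> Bad" using that s(1) unfolding Bad_def by (intro UN_I[of "(N, i)"]) auto
      then show False using s(2) by simp
    qed
  qed
qed

section \<open>Concentration in the random digraph\<close>

lemma finite_all_arcs: "finite (all_arcs n)"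
proof (rule finite_subset)
  show "all_arcs n \<subseteq> {..<n} \<times> {..<n}" by (auto simp: all_arcs_def)
qed auto

definition arc_weight :: "nat \<Rightarrow> real \<Rightarrow> (nat \<times> nat) set \<Rightarrow> real" where
  "arc_weight n p D = p ^ card D * (1 - p) ^ (card (all_arcs n) - card D)"

lemma arc_weight_nonneg: "0 \<le> p \<Longrightarrow> p \<le> 1 \<Longrightarrow> 0 \<le> arc_weight n p D"
  by (simp add: arc_weight_def)

lemma Dnp_prob_eq: "Dnp_prob n p P = (\<Sum>D\<in>Pow (all_arcs n). if P D then arc_weight n p D else 0)"
  unfolding Dnp_prob_def arc_weight_def ..

text \<open>Expanding the product over all arcs of (present + absent), with present arcs of
  \<open>E\<close> marked by \<open>x\<close>, gives the generating function of card (D \<inter> E).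
  For empty \<open>E\<close> it says that the total mass is 1.\<close>

lemma arc_weight_mgf:
  assumes E: "E \<subseteq> all_arcs n"
  shows "(\<Sum>D\<in>Pow (all_arcs n). arc_weight n p D * x ^ card (D \<inter> E)) = (1 - p + p * x) ^ card E"
proof -
  let ?A = "all_arcs n"
  have "(\<Sum>D\<in>Pow ?A. arc_weight n p D * x ^ card (D \<inter> E)) =
    (\<Sum>D\<in>Pow ?A. (\<Prod>a\<in>D. p * (if a \<in> E then x else 1)) * (\<Prod>a\<in>?A - D. 1 - p))"
  proof (rule sum.cong)
    fix D assume "D \<in> Pow ?A"
    then have D: "D \<subseteq> ?A" "finite D" using finite_all_arcs finite_subset by auto
    have "(\<Prod>a\<in>D. p * (if a \<in> E then x else 1)) = p ^ card D * x ^ card (D \<inter> E)"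
      using D by (simp add: prod.distrib prod.If_cases)
    moreover have "(\<Prod>a\<in>?A - D. 1 - p) = (1 - p) ^ (card ?A - card D)"
      using D by (simp add: card_Diff_subset)
    ultimately show "arc_weight n p D * x ^ card (D \<inter> E) =
        (\<Prod>a\<in>D. p * (if a \<in> E then x else 1)) * (\<Prod>a\<in>?A - D. 1 - p)"
      by (simp add: arc_weight_def)
  qed simp
  also have "\<dots> = (\<Prod>a\<in>?A. p * (if a \<in> E then x else 1) + (1 - p))"
    using finite_all_arcs by (subst prod_add) auto
  also have "\<dots> = (\<Prod>a\<in>?A. if a \<in> E then 1 - p + p * x else 1)"
    by (intro prod.cong) auto
  also have "\<dots> = (1 - p + p * x) ^ card E"
    using E finite_all_arcs by (simp add: prod.If_cases Int_absorb1)
  finally show ?thesis .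
qed

lemma Dnp_prob_compl: "Dnp_prob n p P = 1 - Dnp_prob n p (\<lambda>D. \<not> P D)"
proof -
  have "Dnp_prob n p P + Dnp_prob n p (\<lambda>D. \<not> P D) = (\<Sum>D\<in>Pow (all_arcs n). arc_weight n p D * 1 ^ card (D \<inter> {}))"
    unfolding Dnp_prob_eq sum.distrib[symmetric] by (intro sum.cong) auto
  also have "\<dots> = 1" by (subst arc_weight_mgf) auto
  finally show ?thesis by simp
qed

context
  fixes n :: nat and p :: real
  assumes p: "0 \<le> p" "p \<le> 1"
begin

lemma Dnp_prob_mono:
  assumes "\<And>D. D \<subseteq> all_arcs n \<Longrightarrow> P D \<Longrightarrow> Q D"
  shows "Dnp_prob n p P \<le> Dnp_prob n p Q"
  unfolding Dnp_prob_eq using assms arc_weight_nonneg[OF p] by (intro sum_mono) auto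

lemma Dnp_prob_nonneg: "0 \<le> Dnp_prob n p P"
  unfolding Dnp_prob_eq using arc_weight_nonneg[OF p] by (intro sum_nonneg) auto

lemma Dnp_prob_le_1: "Dnp_prob n p P \<le> 1"
  using Dnp_prob_compl[of n p P] Dnp_prob_nonneg[of "\<lambda>D. \<not> P D"] by simp

lemma Dnp_prob_Un: "Dnp_prob n p (\<lambda>D. P D \<or> Q D) \<le> Dnp_prob n p P + Dnp_prob n p Q"
  unfolding Dnp_prob_eq sum.distrib[symmetric] using arc_weight_nonneg[OF p] by (intro sum_mono) auto

lemma Dnp_prob_Bex:
  assumes "finite I"
  shows "Dnp_prob n p (\<lambda>D. \<exists>i\<in>I. P i D) \<le> (\<Sum>i\<in>I. Dnp_prob n p (P i))"
  using assms
proof (induction I)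
  case empty
  then show ?case by (simp add: Dnp_prob_def)
next
  case (insert j I)
  have "Dnp_prob n p (\<lambda>D. \<exists>i\<in>insert j I. P i D) \<le> Dnp_prob n p (P j) + Dnp_prob n p (\<lambda>D. \<exists>i\<in>I. P i D)"
    using Dnp_prob_Un[of "P j" "\<lambda>D. \<exists>i\<in>I. P i D"] by simp
  then show ?case using insert by simp
qed

text \<open>One form for both tails: the hypothesis on \<open>P\<close> expresses a lower bound on
  the arc count for x > 1 and an upper bound for x < 1.\<close>

lemma Dnp_prob_markov:
  assumes E: "E \<subseteq> all_arcs n" and x: "0 < x"
    and P: "\<And>D. P D \<Longrightarrow> x powr L \<le> x ^ card (D \<inter> E)"
  shows "Dnp_prob n p P \<le> exp (p * card E * (x - 1) - L * ln x)"
proof -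
  have "Dnp_prob n p P * x powr L = (\<Sum>D\<in>Pow (all_arcs n). if P D then arc_weight n p D * x powr L else 0)"
    unfolding Dnp_prob_eq sum_distrib_right by (intro sum.cong) auto
  also have "\<dots> \<le> (\<Sum>D\<in>Pow (all_arcs n). arc_weight n p D * x ^ card (D \<inter> E))"
    using arc_weight_nonneg[OF p] P x by (intro sum_mono) (auto intro!: mult_left_mono)
  also have "\<dots> = (1 + p * (x - 1)) ^ card E"
    using arc_weight_mgf[OF E] by (simp add: algebra_simps)
  also have "\<dots> \<le> exp (p * (x - 1)) ^ card E"
  proof (rule power_mono)
    show "0 \<le> 1 + p * (x - 1)"
      using p mult_nonneg_nonneg[OF p(1) less_imp_le[OF x]] unfolding right_diff_distrib by linarith
  qed (rule exp_ge_add_one_self)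
  also have "\<dots> = exp (p * card E * (x - 1))"
    by (simp add: exp_of_nat_mult[symmetric] algebra_simps)
  finally have "Dnp_prob n p P \<le> exp (p * card E * (x - 1)) / x powr L"
    using x by (simp add: field_simps)
  also have "\<dots> = exp (p * card E * (x - 1) - L * ln x)"
    using x by (simp add: powr_def exp_diff)
  finally show ?thesis .
qed

text \<open>\<open>\<mu>\<close> is any upper bound for the mean. This matters for small vertex
  sets, where the deviation is measured against a logarithmic term far above the mean.\<close>

lemma chernoff_upper:
  assumes E: "E \<subseteq> all_arcs n" and \<mu>: "p * card E \<le> \<mu>" and \<eta>: "0 < \<eta>" "\<eta> \<le> 1 / 2"
  shows "Dnp_prob n p (\<lambda>D. (1 + \<eta>) * \<mu> \<le> card (D \<inter> E)) \<le> exp (- \<eta>\<^sup>2 * \<mu> / 8)"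
proof -
  \<comment> \<open>The exponent -\<eta> y + (1 + \<eta>) y^2 is minimal at y = \<eta> / (2 (1 +
    \<eta>)), which is \<eta> / 3 in the extreme case \<eta> = 1 / 2.\<close>
  define y where "y = \<eta> / 3"
  have y: "0 < y" "y \<le> 1" using \<eta> by (auto simp: y_def)
  have \<mu>0: "0 \<le> \<mu>" using \<mu> p by (meson mult_nonneg_nonneg of_nat_0_le_iff order_trans)
  have "Dnp_prob n p (\<lambda>D. (1 + \<eta>) * \<mu> \<le> card (D \<inter> E)) \<le>
      exp (p * card E * ((1 + y) - 1) - ((1 + \<eta>) * \<mu>) * ln (1 + y))"
  proof (rule Dnp_prob_markov[OF E])
    fix D assume "(1 + \<eta>) * \<mu> \<le> card (D \<inter> E)"
    then have "(1 + y) powr ((1 + \<eta>) * \<mu>) \<le> (1 + y) powr card (D \<inter> E)"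
      using y by (intro powr_mono) auto
    then show "(1 + y) powr ((1 + \<eta>) * \<mu>) \<le> (1 + y) ^ card (D \<inter> E)"
      using y by (simp add: powr_realpow)
  qed (use y in auto)
  also have "\<dots> \<le> exp (- \<eta>\<^sup>2 * \<mu> / 8)"
  proof -
    have "y - y\<^sup>2 \<le> ln (1 + y)" using y by (intro ln_one_plus_pos_lower_bound) auto
    then have "((1 + \<eta>) * \<mu>) * (y - y\<^sup>2) \<le> ((1 + \<eta>) * \<mu>) * ln (1 + y)"
      using \<eta> \<mu>0 by (intro mult_left_mono) auto
    moreover have "p * card E * y \<le> \<mu> * y" using \<mu> y by (intro mult_right_mono) auto
    ultimately have "p * card E * ((1 + y) - 1) - ((1 + \<eta>) * \<mu>) * ln (1 + y) \<le> \<mu> * (y - (1 + \<eta>) * (y - y\<^sup>2))"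
      by (simp add: algebra_simps)
    also have "y - (1 + \<eta>) * (y - y\<^sup>2) = - (\<eta>\<^sup>2 / 3) + (1 + \<eta>) * (\<eta>\<^sup>2 / 9)"
      by (simp add: y_def field_simps power2_eq_square)
    also have "\<mu> * (- (\<eta>\<^sup>2 / 3) + (1 + \<eta>) * (\<eta>\<^sup>2 / 9)) \<le> \<mu> * (- \<eta>\<^sup>2 / 8)"
    proof (rule mult_left_mono[OF _ \<mu>0])
      have "(1 + \<eta>) * (\<eta>\<^sup>2 / 9) \<le> (3 / 2) * (\<eta>\<^sup>2 / 9)" using \<eta> by (intro mult_right_mono) auto
      moreover have "0 \<le> \<eta>\<^sup>2" by simp
      ultimately show "- (\<eta>\<^sup>2 / 3) + (1 + \<eta>) * (\<eta>\<^sup>2 / 9) \<le> - \<eta>\<^sup>2 / 8" by linarith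
    qed
    finally show ?thesis by (simp add: algebra_simps)
  qed
  finally show ?thesis .
qed

lemma chernoff_lower:
  assumes E: "E \<subseteq> all_arcs n" and \<eta>: "0 < \<eta>" "\<eta> \<le> 1"
  shows "Dnp_prob n p (\<lambda>D. card (D \<inter> E) \<le> (1 - \<eta>) * (p * card E)) \<le> exp (- \<eta>\<^sup>2 * (p * card E) / 8)"
proof -
  define \<mu> where "\<mu> = p * card E"
  \<comment> \<open>The minimiser of -\<eta> y + 2 y^2, which is the exponent up to a nonpositive
    term.\<close>
  define y where "y = \<eta> / 4"
  have y: "0 < y" "y \<le> 1 / 2" using \<eta> by (auto simp: y_def)
  have \<mu>0: "0 \<le> \<mu>" using p by (simp add: \<mu>_def)
  have "Dnp_prob n p (\<lambda>D. card (D \<inter> E) \<le> (1 - \<eta>) * \<mu>) \<le>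
      exp (p * card E * ((1 - y) - 1) - ((1 - \<eta>) * \<mu>) * ln (1 - y))"
  proof (rule Dnp_prob_markov[OF E])
    fix D assume "card (D \<inter> E) \<le> (1 - \<eta>) * \<mu>"
    then have "(1 - y) powr ((1 - \<eta>) * \<mu>) \<le> (1 - y) powr card (D \<inter> E)"
      using y by (intro powr_mono') auto
    then show "(1 - y) powr ((1 - \<eta>) * \<mu>) \<le> (1 - y) ^ card (D \<inter> E)"
      using y by (simp add: powr_realpow)
  qed (use y in auto)
  also have "\<dots> \<le> exp (- \<eta>\<^sup>2 * \<mu> / 8)"
  proof -
    have "- y - 2 * y\<^sup>2 \<le> ln (1 - y)" using y by (intro ln_one_minus_pos_lower_bound) auto
    then have "((1 - \<eta>) * \<mu>) * (- y - 2 * y\<^sup>2) \<le> ((1 - \<eta>) * \<mu>) * ln (1 - y)"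
      using \<eta> \<mu>0 by (intro mult_left_mono) auto
    then have "p * card E * ((1 - y) - 1) - ((1 - \<eta>) * \<mu>) * ln (1 - y) \<le> \<mu> * (- y + (1 - \<eta>) * (y + 2 * y\<^sup>2))"
      by (simp add: algebra_simps \<mu>_def)
    also have "- y + (1 - \<eta>) * (y + 2 * y\<^sup>2) = - (\<eta>\<^sup>2 / 4) + (1 - \<eta>) * (\<eta>\<^sup>2 / 8)"
      by (simp add: y_def field_simps power2_eq_square)
    also have "\<mu> * (- (\<eta>\<^sup>2 / 4) + (1 - \<eta>) * (\<eta>\<^sup>2 / 8)) \<le> \<mu> * (- \<eta>\<^sup>2 / 8)"
    proof (rule mult_left_mono[OF _ \<mu>0])
      have "(1 - \<eta>) * (\<eta>\<^sup>2 / 8) \<le> 1 * (\<eta>\<^sup>2 / 8)" using \<eta> by (intro mult_right_mono) auto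
      then show "- (\<eta>\<^sup>2 / 4) + (1 - \<eta>) * (\<eta>\<^sup>2 / 8) \<le> - \<eta>\<^sup>2 / 8" by linarith
    qed
    finally show ?thesis by (simp add: algebra_simps)
  qed
  finally show ?thesis by (simp add: \<mu>_def)
qed

end

section \<open>Typical properties of the random digraph\<close>

definition near_regular :: "nat \<Rightarrow> real \<Rightarrow> real \<Rightarrow> (nat \<times> nat) set \<Rightarrow> bool" where
  "near_regular n p b D \<longleftrightarrow> (\<forall>v<n. (1 - b) * (p * n) \<le> card (D `` {v}) \<and> (1 - b) * (p * n) \<le> card (D\<inverse> `` {v}))"

text \<open>These degrees bound the cost of deleting the cut from the lower to the upper half of the
  vertices.\<close>

definition half_bounded :: "nat \<Rightarrow> real \<Rightarrow> (nat \<times> nat) set \<Rightarrow> bool" where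
  "half_bounded n K D \<longleftrightarrow> (\<forall>v<n. real (card (D `` {v} \<inter> {n div 2..<n})) \<le> K \<and> real (card (D\<inverse> `` {v} \<inter> {0..<n div 2})) \<le> K)"

text \<open>The constant 16/b^2 makes the failure probability at most n to the power -2(card S + card T)
  for each pair, which is summable over all pairs of nonempty sets.\<close>

definition jumbled :: "nat \<Rightarrow> real \<Rightarrow> real \<Rightarrow> (nat \<times> nat) set \<Rightarrow> bool" where
  "jumbled n p b D \<longleftrightarrow> (\<forall>S T. S \<subseteq> {0..<n} \<longrightarrow> T \<subseteq> {0..<n} \<longrightarrow> S \<noteq> {} \<longrightarrow> T \<noteq> {} \<longrightarrow>
     card (D \<inter> S \<times> T) \<le> (1 + b) * max (p * (real (card S) * real (card T))) (16 / b\<^sup>2 * real (card S + card T) * ln (real n)))"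

lemma card_star:
  fixes v n :: nat
  shows "card ({v} \<times> B) = card B" and "card (B \<times> {v}) = card B"
    and "card (D \<inter> {v} \<times> B) = card (D `` {v} \<inter> B)" and "card (D \<inter> B \<times> {v}) = card (D\<inverse> `` {v} \<inter> B)"
proof -
  show "card ({v} \<times> B) = card B" "card (B \<times> {v}) = card B" by (simp_all add: card_cartesian_product)
  have "D \<inter> {v} \<times> B = Pair v ` (D `` {v} \<inter> B)" by auto
  then show "card (D \<inter> {v} \<times> B) = card (D `` {v} \<inter> B)" by (simp add: card_image inj_on_def)
  have "D \<inter> B \<times> {v} = (\<lambda>u. (u, v)) ` (D\<inverse> `` {v} \<inter> B)" by auto
  then show "card (D \<inter> B \<times> {v}) = card (D\<inverse> `` {v} \<inter> B)" by (simp add: card_image inj_on_def)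
qed

text \<open>Without loops the mean degree is p (n - 1). One half of the slack b is the deviation in
  Chernoff's inequality; the other half, through \<open>2 / b \<le> n\<close>, pays for replacing n
  - 1 by n.\<close>

lemma prob_not_near_regular:
  assumes p: "0 \<le> p" "p \<le> 1" and b: "0 < b" "b \<le> 1" and n: "2 / b \<le> n"
  shows "Dnp_prob n p (\<lambda>D. \<not> near_regular n p b D) \<le> 2 * n * exp (- b\<^sup>2 * (p * (real n - 1)) / 32)"
proof -
  define P1 where "P1 v D \<longleftrightarrow> card (D \<inter> {v} \<times> ({0..<n} - {v})) \<le> (1 - b / 2) * (p * card ({v} \<times> ({0..<n} - {v})))"
    for v :: nat and D :: "(nat \<times> nat) set"
  define P2 where "P2 v D \<longleftrightarrow> card (D \<inter> ({0..<n} - {v}) \<times> {v}) \<le> (1 - b / 2) * (p * card (({0..<n} - {v}) \<times> {v}))"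
    for v :: nat and D :: "(nat \<times> nat) set"
  have n0: "0 < n" using n b by (cases n) (auto simp: field_simps)
  have cn: "real (card ({0..<n} - {v})) = real n - 1" if "v < n" for v
    using that by (simp add: of_nat_diff)
  have bound: "(1 - b) * (p * n) \<le> (1 - b / 2) * (p * (real n - 1))"
  proof -
    have bn: "2 \<le> b * n" using n b by (simp add: field_simps)
    have e: "(1 - b) * n = real n - b * n" "(1 - b / 2) * (real n - 1) = real n - 1 - b * n / 2 + b / 2"
      by (simp_all add: field_simps)
    have "(1 - b) * n \<le> (1 - b / 2) * (real n - 1)" unfolding e using bn b by linarith
    then have "p * ((1 - b) * n) \<le> p * ((1 - b / 2) * (real n - 1))" using p by (intro mult_left_mono)
    then show ?thesis by (simp only: mult.left_commute[of p])
  qed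
  have tail1: "Dnp_prob n p (P1 v) \<le> exp (- b\<^sup>2 * (p * (real n - 1)) / 32)" if "v < n" for v
  proof -
    have "Dnp_prob n p (P1 v) \<le> exp (- (b / 2)\<^sup>2 * (p * card ({v} \<times> ({0..<n} - {v}))) / 8)"
      unfolding P1_def using p b that by (intro chernoff_lower) (auto simp: all_arcs_def)
    then show ?thesis using that by (simp add: card_star(1) cn power_divide)
  qed
  have tail2: "Dnp_prob n p (P2 v) \<le> exp (- b\<^sup>2 * (p * (real n - 1)) / 32)" if "v < n" for v
  proof -
    have "Dnp_prob n p (P2 v) \<le> exp (- (b / 2)\<^sup>2 * (p * card (({0..<n} - {v}) \<times> {v})) / 8)"
      unfolding P2_def using p b that by (intro chernoff_lower) (auto simp: all_arcs_def)
    then show ?thesis using that by (simp add: card_star(2) cn power_divide)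
  qed
  have "Dnp_prob n p (\<lambda>D. \<not> near_regular n p b D) \<le>
      Dnp_prob n p (\<lambda>D. (\<exists>v\<in>{..<n}. P1 v D) \<or> (\<exists>v\<in>{..<n}. P2 v D))"
  proof (rule Dnp_prob_mono[OF p])
    fix D assume D: "D \<subseteq> all_arcs n" "\<not> near_regular n p b D"
    then obtain v where v: "v < n" "\<not> (1 - b) * (p * n) \<le> card (D `` {v}) \<or> \<not> (1 - b) * (p * n) \<le> card (D\<inverse> `` {v})"
      by (auto simp: near_regular_def)
    have "D `` {v} \<inter> ({0..<n} - {v}) = D `` {v}" "D\<inverse> `` {v} \<inter> ({0..<n} - {v}) = D\<inverse> `` {v}"
      using D(1) by (auto simp: all_arcs_def)
    then have e: "card (D \<inter> {v} \<times> ({0..<n} - {v})) = card (D `` {v})"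
      "card (D \<inter> ({0..<n} - {v}) \<times> {v}) = card (D\<inverse> `` {v})"
      by (simp_all only: card_star(3,4))
    have "P1 v D \<or> P2 v D"
      using v(2) bound unfolding P1_def P2_def e card_star(1,2) cn[OF v(1)] by linarith
    then show "(\<exists>v\<in>{..<n}. P1 v D) \<or> (\<exists>v\<in>{..<n}. P2 v D)" using v by auto
  qed
  also have "\<dots> \<le> Dnp_prob n p (\<lambda>D. \<exists>v\<in>{..<n}. P1 v D) + Dnp_prob n p (\<lambda>D. \<exists>v\<in>{..<n}. P2 v D)"
    by (rule Dnp_prob_Un[OF p])
  also have "\<dots> \<le> (\<Sum>v\<in>{..<n}. Dnp_prob n p (P1 v)) + (\<Sum>v\<in>{..<n}. Dnp_prob n p (P2 v))"
    by (intro add_mono Dnp_prob_Bex[OF p]) auto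
  also have "\<dots> \<le> (\<Sum>v\<in>{..<n}. exp (- b\<^sup>2 * (p * (real n - 1)) / 32)) + (\<Sum>v\<in>{..<n}. exp (- b\<^sup>2 * (p * (real n - 1)) / 32))"
    using tail1 tail2 by (intro add_mono sum_mono) auto
  finally show ?thesis by simp
qed

text \<open>The larger half has at most (n + 1) / 2 vertices, and \<open>1 \<le> a * n\<close>
  absorbs this rounding into (1/2 + a/2) n. The remaining a/2 covers the factor 1 + b because b (1 +
  a) \<le> a.\<close>

lemma prob_not_half_bounded:
  assumes p: "0 \<le> p" "p \<le> 1" and a: "0 < a" "1 \<le> a * n"
  defines "b \<equiv> min a 1 / 8"
  shows "Dnp_prob n p (\<lambda>D. \<not> half_bounded n ((1 / 2 + a) * n * p) D) \<le> 2 * n * exp (- b\<^sup>2 * (p * n) / 16)"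
proof -
  define \<mu> where "\<mu> = (1 / 2 + a / 2) * (p * n)"
  define A where "A v B = ({v} \<times> B) \<inter> all_arcs n" for v B
  define A' where "A' v B = (B \<times> {v}) \<inter> all_arcs n" for v B
  define P1 where "P1 v D \<longleftrightarrow> (1 + b) * \<mu> \<le> card (D \<inter> A v {n div 2..<n})" for v D
  define P2 where "P2 v D \<longleftrightarrow> (1 + b) * \<mu> \<le> card (D \<inter> A' v {0..<n div 2})" for v D
  have b: "0 < b" "b \<le> 1 / 2" using a by (auto simp: b_def)
  have half: "p * card B \<le> \<mu>" if "2 * card B \<le> n + 1" for B :: "nat set"
  proof -
    have "real (card B) \<le> (1 / 2 + a / 2) * n" using that a by (simp add: field_simps)
    then have "p * card B \<le> p * ((1 / 2 + a / 2) * n)" using p by (intro mult_left_mono) auto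
    then show ?thesis by (simp add: \<mu>_def mult_ac)
  qed
  have bound: "(1 + b) * \<mu> \<le> (1 / 2 + a) * n * p"
  proof -
    have "b * (1 + a) \<le> a"
    proof (cases "a \<le> 1")
      case True
      then have "a * (1 + a) \<le> a * 2" using a by (intro mult_left_mono) auto
      then show ?thesis using True a by (simp add: b_def)
    qed (use a in \<open>simp add: b_def\<close>)
    moreover have "(1 + b) * (1 / 2 + a / 2) = 1 / 2 + a / 2 + (b * (1 + a)) / 2" by (simp add: field_simps)
    ultimately have "(1 + b) * (1 / 2 + a / 2) \<le> 1 / 2 + a" by linarith
    then have "(1 + b) * (1 / 2 + a / 2) * (p * n) \<le> (1 / 2 + a) * (p * n)"
      using p by (intro mult_right_mono) auto
    then show ?thesis by (simp add: \<mu>_def mult_ac)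
  qed
  have \<mu>n: "exp (- b\<^sup>2 * \<mu> / 8) \<le> exp (- b\<^sup>2 * (p * n) / 16)"
  proof -
    have "(p * n) / 2 \<le> \<mu>" using a p by (simp add: \<mu>_def field_simps)
    then have "b\<^sup>2 * ((p * n) / 2) \<le> b\<^sup>2 * \<mu>" by (intro mult_left_mono) auto
    then show ?thesis by (simp add: mult_ac)
  qed
  have cA: "card (A v B) \<le> card B" "card (A' v B) \<le> card B" if "finite B" for v B
    using that unfolding A_def A'_def
    by (metis card_mono card_star(1) finite.emptyI finite_SigmaI finite_insert inf_le1,
        metis card_mono card_star(2) finite.emptyI finite_SigmaI finite_insert inf_le1)
  have pA: "p * card (A v B) \<le> \<mu>" "p * card (A' v B) \<le> \<mu>" if "finite B" "2 * card B \<le> n + 1" for v B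
    using half[OF that(2)] mult_left_mono[OF _ p(1), of "card (A v B)" "card B"]
      mult_left_mono[OF _ p(1), of "card (A' v B)" "card B"] cA[OF that(1), of v] by linarith+
  have tail1: "Dnp_prob n p (P1 v) \<le> exp (- b\<^sup>2 * (p * n) / 16)" for v
    unfolding P1_def using pA(1)[of "{n div 2..<n}" v] b
    by (intro order_trans[OF chernoff_upper[OF p] \<mu>n]) (auto simp: A_def)
  have tail2: "Dnp_prob n p (P2 v) \<le> exp (- b\<^sup>2 * (p * n) / 16)" for v
    unfolding P2_def using pA(2)[of "{0..<n div 2}" v] b
    by (intro order_trans[OF chernoff_upper[OF p] \<mu>n]) (auto simp: A'_def)
  have "Dnp_prob n p (\<lambda>D. \<not> half_bounded n ((1 / 2 + a) * n * p) D) \<le>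
      Dnp_prob n p (\<lambda>D. (\<exists>v\<in>{..<n}. P1 v D) \<or> (\<exists>v\<in>{..<n}. P2 v D))"
  proof (rule Dnp_prob_mono[OF p])
    fix D assume D: "D \<subseteq> all_arcs n" "\<not> half_bounded n ((1 / 2 + a) * n * p) D"
    then obtain v where v: "v < n" "\<not> card (D `` {v} \<inter> {n div 2..<n}) \<le> (1 / 2 + a) * n * p \<or>
        \<not> card (D\<inverse> `` {v} \<inter> {0..<n div 2}) \<le> (1 / 2 + a) * n * p"
      by (auto simp: half_bounded_def)
    have "D \<inter> A v B = D \<inter> {v} \<times> B" "D \<inter> A' v B = D \<inter> B \<times> {v}" for B
      using D(1) by (auto simp: A_def A'_def)
    then have "P1 v D \<or> P2 v D"
      using v bound unfolding P1_def P2_def by (auto simp: card_star)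
    then show "(\<exists>v\<in>{..<n}. P1 v D) \<or> (\<exists>v\<in>{..<n}. P2 v D)" using v by auto
  qed
  also have "\<dots> \<le> Dnp_prob n p (\<lambda>D. \<exists>v\<in>{..<n}. P1 v D) + Dnp_prob n p (\<lambda>D. \<exists>v\<in>{..<n}. P2 v D)"
    by (rule Dnp_prob_Un[OF p])
  also have "\<dots> \<le> (\<Sum>v\<in>{..<n}. Dnp_prob n p (P1 v)) + (\<Sum>v\<in>{..<n}. Dnp_prob n p (P2 v))"
    by (intro add_mono Dnp_prob_Bex[OF p]) auto
  also have "\<dots> \<le> (\<Sum>v\<in>{..<n}. exp (- b\<^sup>2 * (p * n) / 16)) + (\<Sum>v\<in>{..<n}. exp (- b\<^sup>2 * (p * n) / 16))"
    using tail1 tail2 by (intro add_mono sum_mono) auto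
  finally show ?thesis by simp
qed

lemma sum_Pow_power_card:
  fixes x :: real
  assumes "finite A"
  shows "(\<Sum>S\<in>Pow A. x ^ card S) = (1 + x) ^ card A"
  using prod_add[OF assms, of "\<lambda>_. x" "\<lambda>_. 1"] by (simp add: add.commute)

text \<open>With x = n^(-2) a pair (S, T) fails with probability at most x^(card S + card T). The
  sum over pairs of nonempty sets factors as ((1 + x)^n - 1)^2, which tends to 0.\<close>

lemma prob_not_jumbled:
  assumes p: "0 \<le> p" "p \<le> 1" and b: "0 < b" "b \<le> 1 / 2" and n: "2 \<le> n"
  shows "Dnp_prob n p (\<lambda>D. \<not> jumbled n p b D) \<le> (exp (1 / n) - 1)\<^sup>2"
proof -
  define \<mu> where "\<mu> S T = max (p * (real (card S) * real (card T))) (16 / b\<^sup>2 * real (card S + card T) * ln (real n))" for S T :: "nat set"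
  define I where "I = Pow {0..<n} - {{}}"
  define x where "x = 1 / (real n)\<^sup>2"
  have tail: "Dnp_prob n p (\<lambda>D. (1 + b) * \<mu> S T \<le> card (D \<inter> (S \<times> T \<inter> all_arcs n))) \<le> x ^ card S * x ^ card T"
    if "S \<in> I" "T \<in> I" for S T
  proof -
    have fin: "finite S" "finite T" using that by (auto simp: I_def intro: finite_subset[of _ "{0..<n}"])
    have "card (S \<times> T \<inter> all_arcs n) \<le> card S * card T"
      using card_mono[of "S \<times> T" "S \<times> T \<inter> all_arcs n"] fin by (simp add: card_cartesian_product)
    then have "p * card (S \<times> T \<inter> all_arcs n) \<le> p * (real (card S) * real (card T))"
      using p by (intro mult_left_mono) (simp_all flip: of_nat_mult)
    then have "p * card (S \<times> T \<inter> all_arcs n) \<le> \<mu> S T" by (simp add: \<mu>_def)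
    then have "Dnp_prob n p (\<lambda>D. (1 + b) * \<mu> S T \<le> card (D \<inter> (S \<times> T \<inter> all_arcs n))) \<le> exp (- b\<^sup>2 * \<mu> S T / 8)"
      using b by (intro chernoff_upper[OF p]) auto
    also have "\<dots> \<le> exp (- (2 * (card S + card T) * ln n))"
    proof -
      have "b\<^sup>2 * (16 / b\<^sup>2 * real (card S + card T) * ln (real n)) \<le> b\<^sup>2 * \<mu> S T"
        unfolding \<mu>_def by (intro mult_left_mono) auto
      moreover have "b\<^sup>2 * (16 / b\<^sup>2 * real (card S + card T) * ln (real n)) = 8 * (2 * (card S + card T) * ln n)"
        using b by simp
      ultimately show ?thesis by simp
    qed
    also have "\<dots> = x ^ card S * x ^ card T"
    proof -
      have "exp (- (2 * (card S + card T) * ln n)) = exp (- 2 * ln n) ^ (card S + card T)"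
        by (simp add: exp_of_nat_mult[symmetric] algebra_simps)
      also have "exp (- 2 * ln n) = x"
        using n by (simp add: x_def exp_minus exp_double inverse_eq_divide)
      finally show ?thesis by (simp add: power_add)
    qed
    finally show ?thesis .
  qed
  have "Dnp_prob n p (\<lambda>D. \<not> jumbled n p b D) \<le>
     Dnp_prob n p (\<lambda>D. \<exists>ST\<in>I \<times> I. (1 + b) * \<mu> (fst ST) (snd ST) \<le> card (D \<inter> (fst ST \<times> snd ST \<inter> all_arcs n)))"
  proof (rule Dnp_prob_mono[OF p])
    fix D assume D: "D \<subseteq> all_arcs n" "\<not> jumbled n p b D"
    then obtain S T where ST: "S \<in> I" "T \<in> I" "\<not> card (D \<inter> S \<times> T) \<le> (1 + b) * \<mu> S T"
      by (auto simp: jumbled_def I_def \<mu>_def)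
    have "D \<inter> (S \<times> T \<inter> all_arcs n) = D \<inter> S \<times> T" using D by auto
    then show "\<exists>ST\<in>I \<times> I. (1 + b) * \<mu> (fst ST) (snd ST) \<le> card (D \<inter> (fst ST \<times> snd ST \<inter> all_arcs n))"
      using ST by (intro bexI[of _ "(S, T)"]) auto
  qed
  also have "\<dots> \<le> (\<Sum>ST\<in>I \<times> I. Dnp_prob n p (\<lambda>D. (1 + b) * \<mu> (fst ST) (snd ST) \<le> card (D \<inter> (fst ST \<times> snd ST \<inter> all_arcs n))))"
    by (intro Dnp_prob_Bex[OF p]) (auto simp: I_def)
  also have "\<dots> \<le> (\<Sum>ST\<in>I \<times> I. x ^ card (fst ST) * x ^ card (snd ST))"
    using tail by (intro sum_mono) auto
  also have "\<dots> = (\<Sum>S\<in>I. x ^ card S)\<^sup>2"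
    by (simp add: power2_eq_square sum_product sum.cartesian_product case_prod_unfold)
  also have "(\<Sum>S\<in>I. x ^ card S) = (1 + x) ^ n - 1"
    unfolding I_def using sum_Pow_power_card[of "{0..<n}" x] by (subst sum_diff) auto
  also have "((1 + x) ^ n - 1)\<^sup>2 \<le> (exp (1 / n) - 1)\<^sup>2"
  proof (rule power_mono)
    have "(1 + x) ^ n \<le> exp x ^ n" by (intro power_mono exp_ge_add_one_self) (auto simp: x_def)
    also have "\<dots> = exp (1 / n)" using n by (simp add: exp_of_nat_mult[symmetric] x_def power2_eq_square)
    finally show "(1 + x) ^ n - 1 \<le> exp (1 / n) - 1" by simp
    show "0 \<le> (1 + x) ^ n - 1" by (simp add: x_def one_le_power)
  qed
  finally show ?thesis .
qed

section \<open>Robust Hamiltonicity\<close>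

context
  fixes n m :: nat and p b :: real and D G :: "(nat \<times> nat) set"
  assumes D: "D \<subseteq> all_arcs n" and jumb: "jumbled n p b D" and GD: "G \<subseteq> D"
    and out_deg_ge: "\<And>v. v < n \<Longrightarrow> (1 / 2 + 7 * b) * (p * n) \<le> card (G `` {v})"
    and in_deg_ge: "\<And>v. v < n \<Longrightarrow> (1 / 2 + 7 * b) * (p * n) \<le> card (G\<inverse> `` {v})"
    and b: "0 < b" "b \<le> 1 / 8" and p: "0 < p" "p \<le> 1" and n3: "3 \<le> n"
    and m_large: "64 / b\<^sup>2 * ln n \<le> p * m" and m_small: "30 * m \<le> b * (p * n)" and bm: "1 \<le> b * m"
begin

section \<open>Arc counts after an adversarial deletion\<close>

lemma m_pos: "0 < m"
  using bm by (cases m) auto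

lemma G_sub: "(u, v) \<in> G \<Longrightarrow> u < n" "(u, v) \<in> G \<Longrightarrow> v < n" "G \<subseteq> all_arcs n"
  using D GD by (auto simp: all_arcs_def)

lemma m_le: "30 * m \<le> b * n" "30 * m \<le> n"
proof -
  have "p * n \<le> 1 * real n" using p by (intro mult_right_mono) auto
  then have "b * (p * n) \<le> b * n" using b by (intro mult_left_mono) auto
  then show "30 * m \<le> b * n" using m_small by simp
  have "b * n \<le> 1 * real n" using b by (intro mult_right_mono) auto
  then show "30 * m \<le> n" using \<open>30 * m \<le> b * n\<close> by linarith
qed

text \<open>\<open>K\<close> has to dominate both terms of the maximum in \<open>jumbled\<close>.
  Since 64 = 4 * 16, the lower bound on p m puts the logarithmic term below (card S + card T) p m /
  4.\<close>

lemma arcs_between_le: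
  assumes "S \<subseteq> {0..<n}" "T \<subseteq> {0..<n}" "p * (real (card S) * real (card T)) \<le> K"
    "(card S + card T) * (p * m) \<le> 4 * K"
  shows "card (G \<inter> S \<times> T) \<le> (1 + b) * K"
proof (cases "S = {} \<or> T = {}")
  case True
  then have "card (G \<inter> S \<times> T) = 0" by auto
  moreover have "0 \<le> (card S + card T) * (p * m)" using p by simp
  ultimately show ?thesis using assms(4) b by simp
next
  case False
  have fin: "finite (D \<inter> S \<times> T)"
    using D finite_all_arcs[of n] by (meson finite_Int finite_subset)
  have "card (G \<inter> S \<times> T) \<le> card (D \<inter> S \<times> T)"
    using GD by (intro card_mono fin) auto
  then have "card (G \<inter> S \<times> T) \<le> (1 + b) * max (p * (real (card S) * real (card T))) (16 / b\<^sup>2 * real (card S + card T) * ln (real n))"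
    using jumb False assms(1,2) unfolding jumbled_def by (meson of_nat_mono order_trans)
  also have "\<dots> \<le> (1 + b) * K"
  proof (rule mult_left_mono)
    have "4 * (16 / b\<^sup>2 * real (card S + card T) * ln (real n)) = real (card S + card T) * (64 / b\<^sup>2 * ln n)"
      by simp
    also have "\<dots> \<le> real (card S + card T) * (p * m)"
      using m_large by (intro mult_left_mono) auto
    also have "\<dots> \<le> 4 * K" by (rule assms(4))
    finally have "16 / b\<^sup>2 * real (card S + card T) * ln (real n) \<le> K" by linarith
    then show "max (p * (real (card S) * real (card T))) (16 / b\<^sup>2 * real (card S + card T) * ln (real n)) \<le> K"
      using assms(3) by simp
  qed (use b in auto)
  finally show ?thesis .
qed

text \<open>The sparsity needed for Hall's condition, with K = p s (m + 1) / 2. The factor 4 in the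
  second condition on \<open>K\<close> is what this choice affords: (s + s) p m \<le> 2 s p (m + 1)
  = 4 K. The rounding in (m + 1) / 2 is absorbed by \<open>1 \<le> b * m\<close>.\<close>

lemma few_arcs:
  assumes "S \<subseteq> {0..<n}" "T \<subseteq> {0..<n}" "card S \<le> s" "card T \<le> s" "0 < s" "2 * s \<le> m + 1"
  shows "card (G \<inter> S \<times> T) < ((1 / 2 + 4 * b) * (p * m)) * s"
proof -
  have "card (G \<inter> S \<times> T) \<le> (1 + b) * (p * s * ((m + 1) / 2))"
  proof (rule arcs_between_le[OF assms(1,2)])
    have "real (card S) * real (card T) \<le> s * ((m + 1) / 2)"
      using assms(3,4,6) by (intro mult_mono) auto
    then show "p * (real (card S) * real (card T)) \<le> p * s * ((m + 1) / 2)"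
      using p by (simp add: mult.assoc)
    have "(card S + card T) * (p * m) \<le> (2 * s) * (p * (m + 1))"
      using assms(3,4) p by (intro mult_mono) auto
    also have "\<dots> = 4 * (p * s * ((m + 1) / 2))" by simp
    finally show "(card S + card T) * (p * m) \<le> 4 * (p * s * ((m + 1) / 2))" .
  qed
  also have "\<dots> < ((1 / 2 + 4 * b) * (p * m)) * s"
  proof -
    have "(1 + b) * (m + 1) < (1 + 8 * b) * m" using bm b by (simp add: algebra_simps)
    then have "(p * s / 2) * ((1 + b) * (m + 1)) < (p * s / 2) * ((1 + 8 * b) * m)"
      using p assms(5) by (intro mult_strict_left_mono) auto
    then show ?thesis by (simp add: field_simps)
  qed
  finally show ?thesis .
qed

text \<open>An m-set whose neighbourhood fits into \<open>B\<close> would have at least m (1/2 + 7b)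
  p n arcs to \<open>B\<close>. As 28 m \<le> b n, such a \<open>B\<close> has at most (1/2 + b/2) n
  vertices, and jumbledness leaves room for only about half of m p n arcs.\<close>

lemma expansion_bound:
  assumes "A \<subseteq> {0..<n}" "card A = m" "B \<subseteq> {0..<n}" "2 * card B \<le> n + 28 * m"
  shows "card (G \<inter> A \<times> B) < m * ((1 / 2 + 7 * b) * (p * n))"
    and "card (G \<inter> B \<times> A) < m * ((1 / 2 + 7 * b) * (p * n))"
proof -
  define K where "K = p * m * ((1 / 2 + b / 2) * n)"
  have "2 * real (card B) \<le> n + 28 * m" using assms(4) by (simp flip: of_nat_mult of_nat_add)
  then have B: "real (card B) \<le> (1 / 2 + b / 2) * n"
    using m_le(1) by (simp add: algebra_simps)
  have K1: "p * (real m * real (card B)) \<le> K"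
    unfolding K_def mult.assoc using B p by (intro mult_left_mono) auto
  have "0 \<le> b * n" using b by simp
  moreover have "(1 / 2 + b / 2) * n = real n / 2 + b * n / 2" by (simp add: field_simps)
  ultimately have "real (m + card B) \<le> 4 * ((1 / 2 + b / 2) * n)"
    using B of_nat_mono[OF m_le(2), where 'a = real] by simp
  then have K2: "(m + card B) * (p * m) \<le> 4 * K"
    unfolding K_def using p mult_right_mono[of "real (m + card B)" "4 * ((1 / 2 + b / 2) * n)" "p * m"] by (simp add: mult_ac)
  have "(1 + b) * K < m * ((1 / 2 + 7 * b) * (p * n))"
  proof -
    have "b * b \<le> b * 1" using b by (intro mult_left_mono) auto
    then have "(1 + b) * (1 / 2 + b / 2) < 1 / 2 + 7 * b" using b by (simp add: field_simps)
    then have "(1 + b) * (1 / 2 + b / 2) * (p * m * n) < (1 / 2 + 7 * b) * (p * m * n)"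
      using p m_pos n3 by (intro mult_strict_right_mono) auto
    then show ?thesis by (simp add: K_def mult_ac)
  qed
  then show "card (G \<inter> A \<times> B) < m * ((1 / 2 + 7 * b) * (p * n))" "card (G \<inter> B \<times> A) < m * ((1 / 2 + 7 * b) * (p * n))"
    using arcs_between_le[of A B K] arcs_between_le[of B A K] assms K1 K2
    by (auto simp: mult_ac add.commute)
qed

lemma expanding: "expanding_digraph n m G"
proof
  show "G \<subseteq> all_arcs n" by (rule G_sub)
  show "0 < m" by (rule m_pos)
  have deg: "30 * m \<le> (1 / 2 + 7 * b) * (p * n)"
  proof -
    have "b * (p * n) \<le> (1 / 2 + 7 * b) * (p * n)" using b p by (intro mult_right_mono) auto
    then show ?thesis using m_small by simp
  qed
  show "30 * m \<le> card (G `` {v})" "30 * m \<le> card (G\<inverse> `` {v})" if "v < n" for v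
    using out_deg_ge[OF that] in_deg_ge[OF that] deg by linarith+
  fix A assume A: "A \<subseteq> {0..<n}" "card A = m"
  have finA: "finite A" using A finite_subset by blast
  have sub: "G `` A \<subseteq> {0..<n}" "G\<inverse> `` A \<subseteq> {0..<n}" using G_sub by (auto simp: Image_def)
  then have fin: "finite (G `` A)" "finite (G\<inverse> `` A)" by (meson finite_subset finite_atLeastLessThan)+
  have "m * ((1 / 2 + 7 * b) * (p * n)) \<le> (\<Sum>a\<in>A. real (card (G `` {a})))"
    unfolding A(2)[symmetric] using A(1) out_deg_ge by (intro sum_bounded_below) auto
  also have "\<dots> = (\<Sum>a\<in>A. real (card (G `` {a} \<inter> G `` A)))"
    by (intro sum.cong refl arg_cong[where f = "\<lambda>X. real (card X)"]) auto
  also have "\<dots> = card (G \<inter> A \<times> G `` A)"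
    using card_arcs_between(1)[OF finA fin(1), of G] by simp
  finally show "n + 28 * m < 2 * card (G `` A)"
    using expansion_bound(1)[OF A sub(1)] by linarith
  have "m * ((1 / 2 + 7 * b) * (p * n)) \<le> (\<Sum>a\<in>A. real (card (G\<inverse> `` {a})))"
    unfolding A(2)[symmetric] using A(1) in_deg_ge by (intro sum_bounded_below) auto
  also have "\<dots> = (\<Sum>a\<in>A. real (card (G\<inverse> `` {a} \<inter> G\<inverse> `` A)))"
    by (intro sum.cong refl arg_cong[where f = "\<lambda>X. real (card X)"]) auto
  also have "\<dots> = card (G \<inter> (G\<inverse> `` A) \<times> A)"
    using card_arcs_between(2)[OF fin(2) finA, of G] by simp
  finally show "n + 28 * m < 2 * card (G\<inverse> `` A)"
    using expansion_bound(2)[OF A sub(2)] by linarith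
qed

text \<open>The at most 26 m vertices outside \<open>W\<close> cost b p n of the degree excess 7b,
  so the mean degree into a part is at least (1/2 + 6b) p m. The random partition may then lose 2b p
  m.\<close>

lemma blocks:
  assumes W: "W \<subseteq> {0..<n}" "card W = k * m" "n \<le> card W + 26 * m"
  obtains V :: "nat \<Rightarrow> nat set" where "\<And>i. i < k \<Longrightarrow> card (V i) = m" "(\<Union>i\<in>{..<k}. V i) = W"
    "\<And>i j. i < k \<Longrightarrow> j < k \<Longrightarrow> i \<noteq> j \<Longrightarrow> V i \<inter> V j = {}"
    "\<And>i v. i < k \<Longrightarrow> v < n \<Longrightarrow> (1 / 2 + 4 * b) * (p * m) \<le> card (G `` {v} \<inter> V i)"
    "\<And>i v. i < k \<Longrightarrow> v < n \<Longrightarrow> (1 / 2 + 4 * b) * (p * m) \<le> card (G\<inverse> `` {v} \<inter> V i)"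
proof -
  define \<N> where "\<N> = (\<lambda>v. G `` {v}) ` {..<n} \<union> (\<lambda>v. G\<inverse> `` {v}) ` {..<n}"
  define \<mu> where "\<mu> = (1 / 2 + 6 * b) * (p * m)"
  define L where "L = (1 / 2 + 4 * b) * (p * m)"
  have finW: "finite W" using W finite_subset by blast
  have k0: "0 < k" using W(2,3) m_le(2) m_pos by (cases k) auto
  have "k * m \<le> n"
    using card_mono[OF _ W(1)] W(2) by simp
  moreover have "k \<le> k * m" using m_pos by simp
  ultimately have kn: "k \<le> n" and km: "real k * m \<le> n" by (linarith, simp flip: of_nat_mult)
  have c\<N>: "card \<N> \<le> 2 * n" "finite \<N>"
  proof -
    have "card \<N> \<le> card ((\<lambda>v. G `` {v}) ` {..<n}) + card ((\<lambda>v. G\<inverse> `` {v}) ` {..<n})"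
      unfolding \<N>_def by (rule card_Un_le)
    also have "\<dots> \<le> n + n"
      using card_image_le[of "{..<n}" "\<lambda>v. G `` {v}"] card_image_le[of "{..<n}" "\<lambda>v. G\<inverse> `` {v}"] by simp
    finally show "card \<N> \<le> 2 * n" by simp
    show "finite \<N>" by (simp add: \<N>_def)
  qed
  have \<mu>: "\<mu> * k \<le> card (N \<inter> W)" if "N \<in> \<N>" for N
  proof -
    have N: "(1 / 2 + 7 * b) * (p * n) \<le> card N" "N \<subseteq> {0..<n}"
      using that out_deg_ge in_deg_ge G_sub by (auto simp: \<N>_def)
    have finN: "finite N" using N(2) finite_subset by blast
    have "card N \<le> card (N \<inter> W) + card ({0..<n} - W)"
    proof -
      have "N \<subseteq> (N \<inter> W) \<union> ({0..<n} - W)" using N(2) by auto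
      then have "card N \<le> card ((N \<inter> W) \<union> ({0..<n} - W))" using finN by (intro card_mono) auto
      also have "\<dots> \<le> card (N \<inter> W) + card ({0..<n} - W)" by (rule card_Un_le)
      finally show ?thesis .
    qed
    moreover have "card ({0..<n} - W) \<le> 26 * m" using W finW by (simp add: card_Diff_subset)
    ultimately have "real (card N) \<le> card (N \<inter> W) + 26 * m" by (simp flip: of_nat_add of_nat_mult)
    moreover have "\<mu> * k \<le> (1 / 2 + 6 * b) * (p * n)"
    proof -
      have "(1 / 2 + 6 * b) * (p * (k * m)) \<le> (1 / 2 + 6 * b) * (p * n)"
        using km b p by (intro mult_left_mono) auto
      then show ?thesis by (simp add: \<mu>_def mult_ac)
    qed
    ultimately show ?thesis using N(1) m_small by (simp add: algebra_simps)
  qed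
  have bound: "card \<N> * k * (exp (- (b / 2) * \<mu>) * (1 - b / 2) powr (- L)) < 1"
  proof -
    have L0: "0 \<le> L" using b p by (simp add: L_def)
    have "- (b / 2) - 2 * (b / 2)\<^sup>2 \<le> ln (1 - b / 2)" using b by (intro ln_one_minus_pos_lower_bound) auto
    then have "L * (- (b / 2) - 2 * (b / 2)\<^sup>2) \<le> L * ln (1 - b / 2)" using L0 by (intro mult_left_mono)
    then have "- (b / 2) * \<mu> - L * ln (1 - b / 2) \<le> - (b / 2) * \<mu> + L * (b / 2 + 2 * (b / 2)\<^sup>2)"
      by (simp add: algebra_simps)
    \<comment> \<open>The terms linear in b cancel. The gap between 6b and 4b contributes -1 inside
      the bracket, the quadratic term of the logarithm (1/2 + 4b) / 2, and b \<le> 1/8 keeps the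
      latter at most 1/2.\<close>
    also have "\<dots> = p * m * (b\<^sup>2 * (- 1 + (1 / 2 + 4 * b) / 2))"
      by (simp add: \<mu>_def L_def field_simps power2_eq_square)
    also have "\<dots> \<le> p * m * (b\<^sup>2 * (- 1 / 2))"
    proof (intro mult_left_mono)
      show "- 1 + (1 / 2 + 4 * b) / 2 \<le> - 1 / 2" using b by (simp add: field_simps)
    qed (use p in auto)
    also have "\<dots> \<le> - 3 * ln n"
    proof -
      have "b\<^sup>2 * (64 / b\<^sup>2 * ln n) \<le> b\<^sup>2 * (p * m)" using m_large by (intro mult_left_mono) auto
      moreover have "b\<^sup>2 * (64 / b\<^sup>2 * ln n) = 64 * ln n" using b by simp
      ultimately have "64 * ln n \<le> b\<^sup>2 * (p * m)" by simp
      moreover have "0 \<le> ln n" using n3 by simp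
      ultimately have "3 * ln n \<le> b\<^sup>2 * (p * m) / 2" by linarith
      then show ?thesis by (simp add: mult_ac)
    qed
    finally have "exp (- (b / 2) * \<mu> - L * ln (1 - b / 2)) \<le> exp (- 3 * ln n)" by (subst exp_le_cancel_iff)
    moreover have "exp (- (b / 2) * \<mu>) * (1 - b / 2) powr (- L) = exp (- (b / 2) * \<mu> - L * ln (1 - b / 2))"
    proof -
      have "(1 - b / 2) powr (- L) = exp (- (L * ln (1 - b / 2)))" using b by (simp add: powr_def)
      then show ?thesis by (simp add: mult_exp_exp)
    qed
    moreover have "exp (- 3 * ln n) = 1 / real n ^ 3"
    proof -
      have "exp (- 3 * ln n) = inverse (exp (ln n) ^ 3)" by (simp add: exp_minus flip: exp_of_nat_mult)
      then show ?thesis using n3 by (simp add: inverse_eq_divide)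
    qed
    ultimately have e: "exp (- (b / 2) * \<mu>) * (1 - b / 2) powr (- L) \<le> 1 / real n ^ 3" by (simp only:)
    \<comment> \<open>At most 2 n neighbourhoods and at most n parts give 2 n^2 events, each of
      probability at most n^(-3).\<close>
    have "real (card \<N> * k) \<le> real (2 * n * n)"
      using c\<N> kn by (intro of_nat_mono mult_mono) auto
    then have "card \<N> * k * (exp (- (b / 2) * \<mu>) * (1 - b / 2) powr (- L)) \<le> real (2 * n * n) * (1 / real n ^ 3)"
      using e by (intro mult_mono) auto
    also have "\<dots> = 2 / n" using n3 by (simp add: power3_eq_cube field_simps)
    also have "\<dots> < 1" using n3 by simp
    finally show ?thesis .
  qed
  obtain V :: "nat \<Rightarrow> nat set" where V: "\<And>i. i < k \<Longrightarrow> card (V i) = m" "(\<Union>i\<in>{..<k}. V i) = W"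
    "\<And>i j. i < k \<Longrightarrow> j < k \<Longrightarrow> i \<noteq> j \<Longrightarrow> V i \<inter> V j = {}"
    "\<And>i N. i < k \<Longrightarrow> N \<in> \<N> \<Longrightarrow> L \<le> card (N \<inter> V i)"
    by (rule balanced_partition[OF finW W(2) k0 c\<N>(2) _ _ \<mu> bound]) (use b in auto)
  show thesis
    by (rule that[of V]) (use V in \<open>auto simp: \<N>_def L_def\<close>)
qed

text \<open>Two partitions are drawn. \<open>X\<close> and \<open>Y\<close> must exist before the
  switches are built, yet they also serve as end blocks of the matchings, so they are taken from a
  first partition, in which every vertex has many neighbours in each part. The second one divides
  the vertices outside \<open>\<Gamma>\<close>.\<close>

lemma robustly_hamiltonian: "hamiltonian n G"
proof -
  interpret expanding_digraph n m G by (rule expanding)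
  define L where "L = (1 / 2 + 4 * b) * (p * m)"
  define k1 where "k1 = n div m"
  have k1: "2 \<le> k1" unfolding k1_def using m_le(2) m_pos
    by (simp add: less_eq_div_iff_mult_less_eq)
  have k1n: "k1 * m \<le> n" "n \<le> k1 * m + m"
    using m_pos mod_less_divisor[of m n] div_mult_mod_eq[of n m] unfolding k1_def by linarith+
  obtain V1 where V1: "\<And>i. i < k1 \<Longrightarrow> card (V1 i) = m" "(\<Union>i\<in>{..<k1}. V1 i) = {0..<k1 * m}"
    "\<And>i j. i < k1 \<Longrightarrow> j < k1 \<Longrightarrow> i \<noteq> j \<Longrightarrow> V1 i \<inter> V1 j = {}"
    "\<And>i v. i < k1 \<Longrightarrow> v < n \<Longrightarrow> L \<le> card (G `` {v} \<inter> V1 i)"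
    "\<And>i v. i < k1 \<Longrightarrow> v < n \<Longrightarrow> L \<le> card (G\<inverse> `` {v} \<inter> V1 i)"
    unfolding L_def by (rule blocks[of "{0..<k1 * m}" k1]) (use k1n in auto)
  have V1n: "V1 i \<subseteq> {0..<n}" if "i < k1" for i
  proof -
    have "V1 i \<subseteq> {0..<k1 * m}" using V1(2) that by blast
    also have "\<dots> \<subseteq> {0..<n}" using k1n(1) by auto
    finally show ?thesis .
  qed
  define X where "X = V1 0"
  define Y where "Y = V1 1"
  have XY: "card X = m" "card Y = m" "X \<inter> Y = {}" "X \<subseteq> {0..<n}" "Y \<subseteq> {0..<n}"
    using V1(1,3) V1n k1 by (auto simp: X_def Y_def)
  have fXY: "finite X" "finite Y" using XY finite_subset by blast+
  obtain x where x: "bij_betw x {0..<m} X" using ex_bij_betw_nat_finite[OF fXY(1)] XY by auto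
  obtain y where y: "bij_betw y {0..<m} Y" using ex_bij_betw_nat_finite[OF fXY(2)] XY by auto
  have xy: "inj_on x {..<m}" "inj_on y {..<m}" "x ` {..<m} = X" "y ` {..<m} = Y"
    using x y by (auto simp: bij_betw_def lessThan_atLeast0)
  \<comment> \<open>As \<open>\<Gamma>\<close> will have 25 m + z - 20 vertices, this
    \<open>z\<close> makes the number of remaining vertices exactly k m.\<close>
  define k where "k = (n + 20 - 25 * m) div m"
  define z where "z = (n + 20 - 25 * m) mod m"
  have z: "z < m" unfolding z_def using m_pos by simp
  have kz: "k * m + z + 25 * m = n + 20"
    using m_le(2) div_mult_mod_eq[of "n + 20 - 25 * m" m] unfolding k_def z_def by linarith
  obtain \<Gamma> M where \<Gamma>: "\<Gamma> \<subseteq> {0..<n}" "M \<subseteq> G" "one_one M" "X \<union> Y \<subseteq> \<Gamma>"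
     "Domain M = \<Gamma> - Y" "Range M = \<Gamma> - X" "card \<Gamma> + 20 = 25 * m + z"
     "\<And>v. v \<in> \<Gamma> \<Longrightarrow> \<exists>j<m. (x j, v) \<in> M\<^sup>*" "switchable M ((\<lambda>j. (x 0, x j)) ` {..<m})"
  proof -
    have "x ` {..<m} \<inter> y ` {..<m} = {}" "x ` {..<m} \<union> y ` {..<m} \<subseteq> {0..<n}" using XY unfolding xy by auto
    from linkage_exists[OF xy(1,2) this z, unfolded xy(3,4)] show ?thesis
      by (elim exE conjE) (rule that, assumption+, erule (1) bspec, assumption)
  qed
  have fin\<Gamma>: "finite \<Gamma>" using \<Gamma>(1) finite_subset by blast
  have cW: "card ({0..<n} - \<Gamma>) = k * m"
    using kz \<Gamma>(1,7) fin\<Gamma> by (simp add: card_Diff_subset)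
  obtain V2 where V2: "\<And>i. i < k \<Longrightarrow> card (V2 i) = m" "(\<Union>i\<in>{..<k}. V2 i) = {0..<n} - \<Gamma>"
    "\<And>i j. i < k \<Longrightarrow> j < k \<Longrightarrow> i \<noteq> j \<Longrightarrow> V2 i \<inter> V2 j = {}"
    "\<And>i v. i < k \<Longrightarrow> v < n \<Longrightarrow> L \<le> card (G `` {v} \<inter> V2 i)"
    "\<And>i v. i < k \<Longrightarrow> v < n \<Longrightarrow> L \<le> card (G\<inverse> `` {v} \<inter> V2 i)"
    unfolding L_def by (rule blocks[of "{0..<n} - \<Gamma>" k]) (use cW kz z in auto)
  define C where "C i = (if i = 0 then Y else if i \<le> k then V2 (i - 1) else X)" for i
  have C: "card (C i) = m" "C i \<subseteq> {0..<n}" "\<And>v. v < n \<Longrightarrow> L \<le> card (G `` {v} \<inter> C i)"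
    "\<And>v. v < n \<Longrightarrow> L \<le> card (G\<inverse> `` {v} \<inter> C i)" for i
  proof -
    have "i - 1 < k" if "i \<noteq> 0" "i \<le> k" using that by simp
    moreover have "V2 j \<subseteq> {0..<n}" if "j < k" for j using V2(2) that by blast
    ultimately show "card (C i) = m" "C i \<subseteq> {0..<n}" "\<And>v. v < n \<Longrightarrow> L \<le> card (G `` {v} \<inter> C i)"
      "\<And>v. v < n \<Longrightarrow> L \<le> card (G\<inverse> `` {v} \<inter> C i)"
      using XY V2(1,4,5) V1(4,5) k1 by (auto simp: C_def X_def Y_def)
  qed
  \<comment> \<open>Beyond \<open>k\<close> every \<open>C i\<close> is \<open>X\<close>, and the
    matching lemma also covers equal sides; one statement for all \<open>i\<close> can thus be
    turned into a choice of \<open>N\<close>.\<close>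
  have "\<exists>N. N \<subseteq> G \<and> one_one N \<and> Domain N = C i \<and> Range N = C (Suc i)" for i
  proof -
    obtain N where "N \<subseteq> G" "one_one N" "Domain N = C i" "Range N = C (Suc i)"
    proof (rule perfect_matching[of "C i" "C (Suc i)" m L G])
      show "finite (C i)" "finite (C (Suc i))" using C(2) finite_subset by blast+
      show "card (C i) = m" "card (C (Suc i)) = m" by (rule C(1))+
      show "L \<le> card (G `` {a} \<inter> C (Suc i))" if "a \<in> C i" for a using C(3)[of a "Suc i"] C(2)[of i] that by auto
      show "L \<le> card (G\<inverse> `` {a} \<inter> C i)" if "a \<in> C (Suc i)" for a using C(4)[of a i] C(2)[of "Suc i"] that by auto
      show "card (G \<inter> S \<times> T) < L * s" if "S \<subseteq> C i" "T \<subseteq> C (Suc i)" "card S \<le> s" "card T \<le> s" "0 < s" "2 * s \<le> m + 1" for S T s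
        unfolding L_def using that C(2) by (intro few_arcs) auto
    qed
    then show ?thesis by blast
  qed
  then obtain N where N: "\<And>i. N i \<subseteq> G" "\<And>i. one_one (N i)" "\<And>i. Domain (N i) = C i" "\<And>i. Range (N i) = C (Suc i)"
    by metis
  have C_ends: "C 0 = Y" "C (Suc k) = X" by (auto simp: C_def)
  have C_disj: "C i \<inter> C j = {}" if "i \<in> {1..k}" "j \<in> {1..k}" "i \<noteq> j" for i j
  proof -
    have "i - 1 < k" "j - 1 < k" "i - 1 \<noteq> j - 1" using that by auto
    then show ?thesis using V2(3)[of "i - 1" "j - 1"] that by (simp add: C_def)
  qed
  have C_Un: "(\<Union>i\<in>{1..k}. C i) = {0..<n} - \<Gamma>"
  proof -
    have "{1..k} = Suc ` {..<k}" by (auto simp: image_Suc_lessThan)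
    then have "(\<Union>i\<in>{1..k}. C i) = (\<Union>i\<in>{..<k}. C (Suc i))" by simp
    also have "\<dots> = (\<Union>i\<in>{..<k}. V2 i)" by (intro SUP_cong) (auto simp: C_def)
    finally show ?thesis using V2(2) by simp
  qed
  show ?thesis
  proof (rule hamiltonian_from_linkage[OF \<Gamma>(1,2,3), of x y C k N, unfolded xy])
    show "X \<union> Y \<subseteq> \<Gamma>" "Domain M = \<Gamma> - Y" "Range M = \<Gamma> - X" by (rule \<Gamma>)+
    show "switchable M ((\<lambda>j. (x 0, x j)) ` {..<m})" by (rule \<Gamma>)
    show "C 0 = Y" "C (Suc k) = X" by (rule C_ends)+
    show "(\<Union>i\<in>{1..k}. C i) = {0..<n} - \<Gamma>" by (rule C_Un)
  qed (rule \<Gamma> C_disj N; assumption)+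
qed

end

section \<open>Local resilience\<close>

text \<open>A Hamilton cycle followed from 0 can never leave the lower half, but it has to visit n -
  1. The bound on \<open>n\<close> makes the lower half contain 0 and not n - 1.\<close>

lemma cut_not_hamiltonian:
  assumes n: "2 \<le> n" and cut: "D \<inter> {0..<n div 2} \<times> {n div 2..<n} = {}"
  shows "\<not> hamiltonian n D"
proof
  assume "hamiltonian n D"
  then obtain vs where vs: "length vs = n" "set vs = {0..<n}"
    "\<And>i. i < n \<Longrightarrow> (vs ! i, vs ! ((i + 1) mod n)) \<in> D"
    unfolding hamiltonian_def by blast
  have lt: "vs ! i < n" if "i < n" for i using vs(1,2) that nth_mem by fastforce
  have "0 \<in> set vs" "n - 1 \<in> set vs" using vs(2) n by auto
  then obtain i0 k where i0: "i0 < n" "vs ! i0 = 0" and k: "k < n" "vs ! k = n - 1"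
    using vs(1) by (metis in_set_conv_nth)
  have low: "vs ! ((i0 + j) mod n) < n div 2" for j
  proof (induction j)
    case 0
    then show ?case using i0 n by simp
  next
    case (Suc j)
    have "(vs ! ((i0 + j) mod n), vs ! ((i0 + Suc j) mod n)) \<in> D"
      using vs(3)[of "(i0 + j) mod n"] n by (simp add: mod_Suc_eq)
    moreover have "vs ! ((i0 + Suc j) mod n) < n" using lt n by simp
    ultimately have "(vs ! ((i0 + j) mod n), vs ! ((i0 + Suc j) mod n)) \<in> D \<inter> {0..<n div 2} \<times> {n div 2..<n}"
      if "\<not> vs ! ((i0 + Suc j) mod n) < n div 2" using Suc that by auto
    then show ?case unfolding cut by blast
  qed
  have "(i0 + (n - i0 + k)) mod n = k" using i0 k by simp
  then have "vs ! k < n div 2" using low by metis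
  then show False using k n by simp
qed

lemma out_deg_Image: "out_deg H u = card (H `` {u})"
  unfolding out_deg_def by (rule arg_cong[where f = card]) auto

lemma in_deg_Image: "in_deg H v = card (H\<inverse> `` {v})"
  unfolding in_deg_def by (rule arg_cong[where f = card]) auto

lemma local_resilience_upper:
  fixes K :: real
  assumes "D \<subseteq> all_arcs n" "half_bounded n K D" "2 \<le> n"
  shows "local_resilience_ham n D \<le> K"
proof -
  define H where "H = D \<inter> {0..<n div 2} \<times> {n div 2..<n}"
  have K: "real (card (D `` {v} \<inter> {n div 2..<n})) \<le> K" "real (card (D\<inverse> `` {v} \<inter> {0..<n div 2})) \<le> K" if "v < n" for v
    using assms(2) that by (auto simp: half_bounded_def)
  have K0: "0 \<le> K" using K(1)[of 0] assms(3) by linarith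
  have "out_deg H u \<le> nat \<lfloor>K\<rfloor>" for u
  proof (cases "u < n div 2")
    case True
    then have "H `` {u} = D `` {u} \<inter> {n div 2..<n}" by (auto simp: H_def)
    then show ?thesis using K(1)[of u] True by (simp add: out_deg_Image le_nat_floor)
  next
    case False
    then have "H `` {u} = {}" by (auto simp: H_def)
    then show ?thesis by (simp add: out_deg_Image)
  qed
  moreover have "in_deg H u \<le> nat \<lfloor>K\<rfloor>" for u
  proof (cases "n div 2 \<le> u \<and> u < n")
    case True
    then have "H\<inverse> `` {u} = D\<inverse> `` {u} \<inter> {0..<n div 2}" by (auto simp: H_def)
    then show ?thesis using K(2)[of u] True by (simp add: in_deg_Image le_nat_floor)
  next
    case False
    then have "H\<inverse> `` {u} = {}" by (auto simp: H_def)
    then show ?thesis by (simp add: in_deg_Image)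
  qed
  moreover have "\<not> hamiltonian n (D - H)"
    by (rule cut_not_hamiltonian[OF assms(3)]) (auto simp: H_def)
  moreover have "H \<subseteq> D" by (auto simp: H_def)
  ultimately have "local_resilience_ham n D \<le> nat \<lfloor>K\<rfloor>"
    unfolding local_resilience_ham_def by (intro Least_le exI[of _ H]) auto
  then show ?thesis using K0 by linarith
qed

text \<open>Deleting every arc shows that r = n is admissible, so the minimum exists. Positivity of
  \<open>n\<close> excludes the empty list, which is a Hamilton cycle on no vertices.\<close>

lemma local_resilience_attained:
  assumes "D \<subseteq> all_arcs n" "0 < n"
  obtains H where "H \<subseteq> D" "\<And>u. card (H `` {u}) \<le> local_resilience_ham n D"
    "\<And>u. card (H\<inverse> `` {u}) \<le> local_resilience_ham n D" "\<not> hamiltonian n (D - H)"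
proof -
  let ?P = "\<lambda>r. \<exists>H. H \<subseteq> D \<and> (\<forall>u. out_deg H u \<le> r) \<and> (\<forall>v. in_deg H v \<le> r) \<and> \<not> hamiltonian n (D - H)"
  have "card (D `` {u}) \<le> n" "card (D\<inverse> `` {u}) \<le> n" for u
  proof -
    have "D `` {u} \<subseteq> {0..<n}" "D\<inverse> `` {u} \<subseteq> {0..<n}" using assms(1) by (auto simp: all_arcs_def)
    then show "card (D `` {u}) \<le> n" "card (D\<inverse> `` {u}) \<le> n"
      using card_mono[of "{0..<n}"] by fastforce+
  qed
  moreover have "\<not> hamiltonian n (D - D)" using assms(2) by (auto simp: hamiltonian_def)
  ultimately have "?P n" by (intro exI[of _ D]) (auto simp: out_deg_Image in_deg_Image)
  then have "?P (LEAST r. ?P r)" by (rule LeastI)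
  then obtain H where "H \<subseteq> D" "\<forall>u. card (H `` {u}) \<le> local_resilience_ham n D"
    "\<forall>u. card (H\<inverse> `` {u}) \<le> local_resilience_ham n D" "\<not> hamiltonian n (D - H)"
    unfolding local_resilience_ham_def out_deg_Image in_deg_Image by blast
  then show thesis by (intro that[of H]) (erule spec | assumption)+
qed

text \<open>If the resilience were smaller, an optimal \<open>H\<close> would leave degrees of at
  least (1 - b) np - (1/2 - a) np, and 8 b \<le> a makes this at least (1/2 + 7b) np. Then
  \<open>D - H\<close> is Hamiltonian, a contradiction.\<close>

lemma local_resilience_lower:
  fixes a p :: real
  defines "b \<equiv> min a 1 / 8"
  assumes a: "0 < a" and p: "0 < p" "p \<le> 1" and D: "D \<subseteq> all_arcs n"
    and reg: "near_regular n p b D" and jumb: "jumbled n p b D"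
    and n1: "1 \<le> ln n" and large: "3840 / b ^ 3 * ln n \<le> n * p\<^sup>2"
  shows "(1 / 2 - a) * n * p \<le> local_resilience_ham n D"
proof (rule ccontr)
  assume small: "\<not> (1 / 2 - a) * n * p \<le> local_resilience_ham n D"
  have n3: "3 \<le> n"
  proof (rule ccontr)
    assume "\<not> 3 \<le> n"
    then have "n \<le> 2" by simp
    then have "ln n \<le> ln 2" using n1 by (cases "n = 0") auto
    then show False using n1 ln_2_less_1 by linarith
  qed
  have b: "0 < b" "b \<le> 1 / 8" "8 * b \<le> a" using a by (auto simp: b_def)
  obtain H where H: "H \<subseteq> D" "\<And>u. card (H `` {u}) \<le> local_resilience_ham n D"
    "\<And>u. card (H\<inverse> `` {u}) \<le> local_resilience_ham n D" "\<not> hamiltonian n (D - H)"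
    using local_resilience_attained[OF D] n3 by auto
  define G where "G = D - H"
  have deg: "(1 / 2 + 7 * b) * (p * n) \<le> card (X - Y)"
    if "(1 - b) * (p * n) \<le> card X" "card Y \<le> local_resilience_ham n D" "Y \<subseteq> X" "finite X" for X Y :: "nat set"
  proof -
    have "real (card (X - Y)) = card X - real (card Y)"
      using that(3,4) card_mono[OF that(4,3)] by (simp add: card_Diff_subset finite_subset of_nat_diff)
    moreover have "real (card Y) \<le> (1 / 2 - a) * n * p" using small that(2) by linarith
    moreover have "(1 / 2 + 7 * b) * (p * n) \<le> (1 - b) * (p * n) - (1 / 2 - a) * n * p"
    proof -
      have "(8 * b) * (p * n) \<le> a * (p * n)" using b p by (intro mult_right_mono) auto
      then show ?thesis by (simp add: algebra_simps)
    qed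
    ultimately show ?thesis using that(1) by linarith
  qed
  have fin: "finite (D `` {v})" "finite (D\<inverse> `` {v})" for v
    using D by (auto intro!: finite_subset[of _ "{0..<n}"] simp: all_arcs_def)
  \<comment> \<open>The least integer with p m \<ge> 64 / b^2 ln n. It is at most twice the real
    number that is rounded, so 30 m \<le> b p n follows from \<open>large\<close>; this is the
    origin of 3840 = 2 * 30 * 64.\<close>
  define m where "m = nat \<lceil>64 / b\<^sup>2 * ln n / p\<rceil>"
  have m0: "0 \<le> 64 / b\<^sup>2 * ln n / p" using n1 p by simp
  then have m1: "64 / b\<^sup>2 * ln n / p \<le> m" and m2: "m \<le> 64 / b\<^sup>2 * ln n / p + 1"
    unfolding m_def by linarith+
  have pm: "64 / b\<^sup>2 * ln n \<le> p * m"
    using iffD1[OF pos_divide_le_eq[OF p(1)] m1] by (simp only: mult.commute)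
  have b3: "b\<^sup>2 \<le> 1" "b ^ 3 \<le> 1" using b by (auto intro: power_le_one)
  have "hamiltonian n G"
  proof (rule robustly_hamiltonian[OF D jumb _ _ _ b(1,2) p n3 pm])
    show "G \<subseteq> D" by (auto simp: G_def)
    show "(1 / 2 + 7 * b) * (p * n) \<le> card (G `` {v})" if "v < n" for v
    proof -
      have "(1 / 2 + 7 * b) * (p * n) \<le> card (D `` {v} - H `` {v})"
        using reg that H fin by (intro deg) (auto simp: near_regular_def)
      also have "\<dots> \<le> card (G `` {v})"
        using fin(1)[of v] by (intro of_nat_mono card_mono finite_subset[of "G `` {v}" "D `` {v}"]) (auto simp: G_def)
      finally show ?thesis .
    qed
    show "(1 / 2 + 7 * b) * (p * n) \<le> card (G\<inverse> `` {v})" if "v < n" for v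
    proof -
      have "(1 / 2 + 7 * b) * (p * n) \<le> card (D\<inverse> `` {v} - H\<inverse> `` {v})"
        using reg that H fin by (intro deg) (auto simp: near_regular_def)
      also have "\<dots> \<le> card (G\<inverse> `` {v})"
        using fin(2)[of v] by (intro of_nat_mono card_mono finite_subset[of "G\<inverse> `` {v}" "D\<inverse> `` {v}"]) (auto simp: G_def)
      finally show ?thesis .
    qed
    have l1: "30 * (64 / b\<^sup>2 * ln n / p) \<le> b * (p * n) / 2"
    proof -
      have "b ^ 3 * (3840 / b ^ 3 * ln n) \<le> b ^ 3 * (n * p\<^sup>2)" using large b by (intro mult_left_mono) auto
      then have "3840 * ln n \<le> b ^ 3 * (n * p\<^sup>2)" using b by simp
      then show ?thesis using b p by (simp add: field_simps power2_eq_square power3_eq_cube)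
    qed
    have "1 \<le> 64 / b\<^sup>2" using b3 b by (simp add: field_simps)
    then have "1 * 1 \<le> 64 / b\<^sup>2 * ln n" using n1 by (intro mult_mono) auto
    then have "1 \<le> 64 / b\<^sup>2 * ln n / p"
      using p by (subst pos_le_divide_eq[OF p(1)]) linarith
    then have "m \<le> 2 * (64 / b\<^sup>2 * ln n / p)" using m2 by linarith
    then have "30 * m \<le> 2 * (b * (p * n) / 2)" using l1 by linarith
    then show "30 * m \<le> b * (p * n)" by simp
    have "64 / b * 1 \<le> 64 / b * ln n" using b n1 by (intro mult_left_mono) auto
    moreover have "1 \<le> 64 / b" using b by (simp add: field_simps)
    moreover have "64 / b * ln n \<le> b * m"
    proof -
      have "64 / b * ln n = b * (64 / b\<^sup>2 * ln n)" using b by (simp add: field_simps power2_eq_square)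
      also have "\<dots> \<le> b * (p * m)" using pm b by (intro mult_left_mono) auto
      also have "\<dots> \<le> b * (1 * real m)" using p b by (intro mult_left_mono mult_right_mono) auto
      finally show ?thesis by simp
    qed
    ultimately show "1 \<le> b * m" by linarith
  qed
  then show False using H(4) by (simp add: G_def)
qed

text \<open>Near-regularity and the cut bound each fail with probability at most 2 / n, from 2 n
  events of probability at most n^(-2); together they give 4 / n. The squared term is the failure of
  jumbledness.\<close>

lemma prob_resilience_bound:
  fixes a p :: real
  defines "b \<equiv> min a 1 / 8"
  assumes a: "0 < a" and p: "0 < p" "p \<le> 1"
    and n1: "1 \<le> ln n" and large: "3840 / b ^ 3 * ln n \<le> n * p\<^sup>2"
  shows "1 - 4 / n - (exp (1 / n) - 1)\<^sup>2 \<le>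
    Dnp_prob n p (\<lambda>D. (1 / 2 - a) * n * p \<le> local_resilience_ham n D \<and> local_resilience_ham n D \<le> (1 / 2 + a) * n * p)"
    (is "_ \<le> Dnp_prob n p ?R")
proof -
  have b: "0 < b" "b \<le> 1 / 8" "8 * b \<le> a" using a by (auto simp: b_def)
  have p0: "0 \<le> p" using p by simp
  have n0: "0 < n" using n1 by (cases n) auto
  have b3: "b ^ 3 \<le> b" "b ^ 3 \<le> b\<^sup>2 * (1 / 8)"
    using b mult_left_mono[of b "1 / 8" "b\<^sup>2"] power_decreasing[of 1 3 b] by (auto simp: power2_eq_square power3_eq_cube)
  have np: "n * p\<^sup>2 \<le> p * n"
  proof -
    have "p * (p * n) \<le> 1 * (p * n)" using p by (intro mult_right_mono) auto
    then show ?thesis by (simp add: power2_eq_square mult_ac)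
  qed
  have big: "3840 * ln n \<le> b ^ 3 * (p * n)"
  proof -
    have "b ^ 3 * (3840 / b ^ 3 * ln n) \<le> b ^ 3 * (p * n)" using large np b by (intro mult_left_mono) auto
    then show ?thesis using b by simp
  qed
  also have "b ^ 3 * (p * n) \<le> (b\<^sup>2 * (1 / 8)) * (p * n)" using b3 p by (intro mult_right_mono) auto
  finally have bpn: "30720 * ln n \<le> b\<^sup>2 * (p * n)" by simp
  have bn: "3840 \<le> b * n"
  proof -
    have "b ^ 3 * (p * n) \<le> b * (1 * real n)" using b3 p b by (intro mult_mono) auto
    then show ?thesis using big n1 by linarith
  qed
  have n2: "2 \<le> n"
  proof -
    have "b * n \<le> 1 * real n" using b by (intro mult_right_mono) auto
    then show ?thesis using bn by linarith
  qed
  have exp2: "2 * n * exp (- t) \<le> 2 / n" if "2 * ln n \<le> t" for t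
  proof -
    have "exp (- t) \<le> exp (- (2 * ln n))" using that by simp
    also have "\<dots> = 1 / (real n * real n)" using n0 by (simp add: exp_minus exp_double inverse_eq_divide power2_eq_square)
    finally have "2 * n * exp (- t) \<le> 2 * n * (1 / (real n * real n))" by (intro mult_left_mono) auto
    then show ?thesis using n0 by simp
  qed
  have "2 / b \<le> n" using bn b by (simp add: field_simps)
  then have "Dnp_prob n p (\<lambda>D. \<not> near_regular n p b D) \<le> 2 * n * exp (- (b\<^sup>2 * (p * (real n - 1)) / 32))"
    using prob_not_near_regular[OF p0 p(2) b(1)] b by simp
  also have "\<dots> \<le> 2 / n"
  proof (rule exp2)
    have "p * n / 2 \<le> p * (real n - 1)" using p n2 by (simp add: field_simps)
    then have "b\<^sup>2 * (p * n / 2) \<le> b\<^sup>2 * (p * (real n - 1))" by (intro mult_left_mono) auto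
    then show "2 * ln n \<le> b\<^sup>2 * (p * (real n - 1)) / 32" using bpn n1 by simp
  qed
  finally have 1: "Dnp_prob n p (\<lambda>D. \<not> near_regular n p b D) \<le> 2 / n" .
  have "1 \<le> a * n"
  proof -
    have "b * n \<le> a * n" using b by (intro mult_right_mono) auto
    then show ?thesis using bn by linarith
  qed
  then have "Dnp_prob n p (\<lambda>D. \<not> half_bounded n ((1 / 2 + a) * n * p) D) \<le> 2 * n * exp (- (b\<^sup>2 * (p * n) / 16))"
    using prob_not_half_bounded[OF p0 p(2) a, of n] unfolding b_def by simp
  also have "\<dots> \<le> 2 / n" using bpn n1 by (intro exp2) simp
  finally have 2: "Dnp_prob n p (\<lambda>D. \<not> half_bounded n ((1 / 2 + a) * n * p) D) \<le> 2 / n" .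
  have 3: "Dnp_prob n p (\<lambda>D. \<not> jumbled n p b D) \<le> (exp (1 / n) - 1)\<^sup>2"
    using b n2 by (intro prob_not_jumbled[OF p0 p(2)]) auto
  have "Dnp_prob n p (\<lambda>D. \<not> ?R D) \<le>
    Dnp_prob n p (\<lambda>D. \<not> near_regular n p b D \<or> \<not> half_bounded n ((1 / 2 + a) * n * p) D \<or> \<not> jumbled n p b D)"
  proof (rule Dnp_prob_mono[OF p0 p(2)])
    fix D assume D: "D \<subseteq> all_arcs n" "\<not> ?R D"
    show "\<not> near_regular n p b D \<or> \<not> half_bounded n ((1 / 2 + a) * n * p) D \<or> \<not> jumbled n p b D"
    proof (rule ccontr)
      assume "\<not> ?thesis"
      then have g: "near_regular n p b D" "half_bounded n ((1 / 2 + a) * n * p) D" "jumbled n p b D" by auto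
      have "?R D"
        using local_resilience_lower[OF a p D(1), folded b_def, OF g(1,3) n1 large]
          local_resilience_upper[OF D(1) g(2) n2] by simp
      then show False using D(2) by simp
    qed
  qed
  also have "\<dots> \<le> Dnp_prob n p (\<lambda>D. \<not> near_regular n p b D) +
      (Dnp_prob n p (\<lambda>D. \<not> half_bounded n ((1 / 2 + a) * n * p) D) + Dnp_prob n p (\<lambda>D. \<not> jumbled n p b D))"
    by (intro order_trans[OF Dnp_prob_Un[OF p0 p(2)]] add_mono Dnp_prob_Un[OF p0 p(2)] order_refl)
  also have "\<dots> \<le> 2 / n + (2 / n + (exp (1 / n) - 1)\<^sup>2)" by (intro add_mono 1 2 3)
  finally show ?thesis using Dnp_prob_compl[of n p ?R] by simp
qed

theorem theorem1p1:
  fixes \<alpha> :: real and p :: "nat \<Rightarrow> real"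
  assumes "\<alpha> > 0"
    and "\<And>n. 0 \<le> p n" and "\<And>n. p n \<le> 1"
    and "(\<lambda>n. ln (real n) / sqrt (real n)) \<in> o(p)"
  shows "(\<lambda>n. Dnp_prob n (p n)
            (\<lambda>D. (1/2 - \<alpha>) * real n * p n \<le> real (local_resilience_ham n D) \<and>
                 real (local_resilience_ham n D) \<le> (1/2 + \<alpha>) * real n * p n))
         \<longlonglongrightarrow> 1"
proof -
  define b where "b = min \<alpha> 1 / 8"
  \<comment> \<open>Chosen so that squaring ln n \<le> c p sqrt n yields the constant 3840 /
    b^3.\<close>
  define c where "c = sqrt (b ^ 3 / 3840)"
  have b: "0 < b" using assms(1) by (simp add: b_def)
  have c: "0 < c" "c\<^sup>2 = b ^ 3 / 3840" using b by (simp_all add: c_def)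
  have ev1: "eventually (\<lambda>n. 1 \<le> ln (real n)) sequentially"
    by real_asymp
  have ev2: "eventually (\<lambda>n. norm (ln (real n) / sqrt (real n)) \<le> c * norm (p n)) sequentially"
    using landau_o.smallD[OF assms(4) c(1)] .
  have lower: "eventually (\<lambda>n. 1 - 4 / n - (exp (1 / n) - 1)\<^sup>2 \<le> Dnp_prob n (p n)
            (\<lambda>D. (1/2 - \<alpha>) * real n * p n \<le> real (local_resilience_ham n D) \<and>
                 real (local_resilience_ham n D) \<le> (1/2 + \<alpha>) * real n * p n)) sequentially"
    using ev1 ev2
  proof eventually_elim
    case (elim n)
    have n0: "0 < real n" using elim(1) by (cases n) auto
    have l: "ln n \<le> c * p n * sqrt n"
      using elim n0 assms(2)[of n] by (simp add: field_simps)
    \<comment> \<open>Positivity of \<open>p n\<close> comes from the growth hypothesis, since ln n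
      is at least 1 here.\<close>
    then have "0 < c * p n * sqrt n" using elim(1) by linarith
    then have p0: "0 < p n" using c n0 by (simp add: zero_less_mult_iff)
    have "ln n \<le> (ln n)\<^sup>2" using elim(1) mult_left_mono[of 1 "ln n" "ln n"] by (simp add: power2_eq_square)
    also have "\<dots> \<le> (c * p n * sqrt n)\<^sup>2" using l elim(1) by (intro power_mono) auto
    also have "\<dots> = b ^ 3 / 3840 * (n * (p n)\<^sup>2)" using n0 by (simp add: power_mult_distrib c(2))
    finally have "3840 / b ^ 3 * ln n \<le> n * (p n)\<^sup>2"
      using b by (simp add: field_simps)
    then show ?case
      using prob_resilience_bound[OF assms(1) p0 assms(3) elim(1), folded b_def] by simp
  qed
  have upper: "eventually (\<lambda>n. Dnp_prob n (p n)
            (\<lambda>D. (1/2 - \<alpha>) * real n * p n \<le> real (local_resilience_ham n D) \<and>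
                 real (local_resilience_ham n D) \<le> (1/2 + \<alpha>) * real n * p n) \<le> 1) sequentially"
    using Dnp_prob_le_1[OF assms(2,3)] by simp
  have lim: "(\<lambda>n. 1 - 4 / real n - (exp (1 / real n) - 1)\<^sup>2) \<longlonglongrightarrow> 1"
    by real_asymp
  show ?thesis
    by (rule tendsto_sandwich[OF lower upper lim tendsto_const])
qed

end
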